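(* Suppose the Lipschitz control model assumption (given in the context) holds. Let $\pi_{\mathrm E}$ be an optimal policy for the MDP with cost $c^\star$ and let $u^\star=V^\star_{c^\star}$ be the corresponding optimal value function. Let $d=\mathrm{leb}(\mathcal X\times\mathcal A)$ be the Lebesgue measure of $\mathcal X\times\mathcal A$. If $u_1\equiv1$ and $\theta>\frac{1}{(1-\gamma)\min\{1,d\}}$, then the optimal value $\tilde\varepsilon$ of the inverse program (IP) satisfies $\tilde\varepsilon\le\varepsilon_{\mathrm{approx}}$, where $$\varepsilon_{\mathrm{approx}}:=\left(\frac{2-\gamma}{1-\gamma}+\mathcal D_{\gamma,\theta}(2+\gamma)\max\{1,L_{\mathsf P},d\}\right)\left(\min_{c\in\mathbf C_{n_c}}\|c^\star-c\|_{\mathrm L}+\min_{u\in\mathbf U_{n_u}}\|u^\star-u\|_{\mathrm L}\right),$$ $$\mathcal D_{\gamma,\theta}:=\frac{2\theta(K_{c,\infty}+K_{u,\infty})}{(1-\gamma)^2\min\{1,d\}\,\theta+\gamma-1},\qquad K_{c,\infty}:=\max_{i=1,\dots,n_c}\|c_i\|_\infty,\qquad K_{u,\infty}:=\max_{j=1,\dots,n_u}\|u_j\|_\infty .$$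
   Context: Function spaces. For a metric space $(X,\rho)$ and $u:X\to\mathbb R$, let $\|u\|_\infty=\sup_x|u(x)|$, $|u|_{\mathrm L}=\sup_{x\ne x'}|u(x)-u(x')|/\rho(x,x')$, $\|u\|_{\mathrm L}=\|u\|_\infty+|u|_{\mathrm L}$. $\operatorname{Lip}(X)$ is the Banach space of bounded Lipschitz functions $X\to\mathbb R$ with norm $\|\cdot\|_{\mathrm L}$. For a finite signed Borel measure $\mu$ on $X$, $\langle\mu,u\rangle=\int_X u\,d\mu$. On $\mathcal X\times\mathcal A$ the metric is $\|x-y\|_2+\|a-b\|_2$; $d(x,a)$ in integrals denotes Lebesgue measure. MDP. $\mathcal M_c=(\mathcal X,\mathcal A,\mathsf P,\gamma,\nu_0,c)$: state space $\mathcal X$ and action space $\mathcal A$ (Borel spaces), transition law $\mathsf P$ (a stochastic kernel on $\mathcal X$ given $\mathcal X\times\mathcal A$), discount factor $\gamma\in(0,1)$, initial distribution $\nu_0$ (a Borel probability measure on $\mathcal X$), cost $c:\mathcal X\times\mathcal A\to\mathbb R$. Policies may be randomized, nonstationary and history-dependent; $\Pi_0$ is the set of stationary Markov policies, i.e. stochastic kernels on $\mathcal A$ given $\mathcal X$. $\mathbb P_{\nu}^\pi$, $\mathbb E_{\nu}^\pi$ are the law and expectation of the trajectory $(x_t,a_t)_{t\ge0}$ under $\pi$ with $x_0\sim\nu$. $V_c^\pi(\nu)=\mathbb E_{\nu}^\pi[\sum_{t\ge0}\gamma^tc(x_t,a_t)]$, $V_c^\star(\nu)=\min_{\pi\in\Pi_0}V_c^\pi(\nu)$;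 $\pi$ is optimal for cost $c$ if $V_c^\pi(\nu_0)=V_c^\star(\nu_0)$; the optimal value function is $V_c^\star(x)=V_c^\star(\delta_x)$, $x\in\mathcal X$. The occupancy measure of $\pi$ is $\mu_{\nu_0}^\pi(E)=\sum_{t\ge0}\gamma^t\mathbb P_{\nu_0}^\pi[(x_t,a_t)\in E]$ for Borel $E\subset\mathcal X\times\mathcal A$. For $u\in\operatorname{Lip}(\mathcal X)$, $\mathsf Pu(x,a)=\int_{\mathcal X}u(y)\,\mathsf P(dy|x,a)$ and $(T_\gamma^*u)(x,a)=u(x)-\gamma\,\mathsf Pu(x,a)$. Lipschitz control model assumption. (A1) $\mathcal X$ and $\mathcal A$ are compact subsets of Euclidean spaces. (A2) $\mathsf P$ is weakly continuous ($\mathsf Pu$ is continuous on $\mathcal X\times\mathcal A$ for every continuous $u:\mathcal X\to\mathbb R$) and there is $L_{\mathsf P}>0$ with $|\mathsf Pu(x,a)-\mathsf Pu(y,b)|\le L_{\mathsf P}|u|_{\mathrm L}(\|x-y\|_2+\|a-b\|_2)$ for all $(x,a),(y,b)\in\mathcal X\times\mathcal A$ and $u\in\operatorname{Lip}(\mathcal X)$. (A3) The cost function $c^\star$ is in $\operatorname{Lip}(\mathcal X\times\mathcal A)$. Function classes. Let $c_1,\dots,c_{n_c}\in\operatorname{Lip}(\mathcal X\times\mathcal A)$ be linearly independent with Lipschitz constant $L_c>0$, let $u_1,\dots,u_{n_u}\in\operatorname{Lip}(\mathcal X)$ be linearly independent with Lipschitz constant $L_u>0$, and let $\theta>0$. Set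 $\mathbf C_{n_c}=\{\sum_{i=1}^{n_c}\alpha_ic_i:\alpha\in\mathbb R^{n_c},\|\alpha\|_1\le\theta\}$ and $\mathbf U_{n_u}=\{\sum_{i=1}^{n_u}\beta_iu_i:\beta\in\mathbb R^{n_u},\|\beta\|_1\le\theta\}$. Inverse program (IP). Minimize $\varepsilon$ over $(\alpha,\beta,\varepsilon)$ with $c=\sum_i\alpha_ic_i\in\mathbf C_{n_c}$, $u=\sum_i\beta_iu_i\in\mathbf U_{n_u}$ and $\varepsilon\ge0$, subject to $\langle\mu_{\nu_0}^{\pi_{\mathrm E}},c-T_\gamma^*u\rangle\le\varepsilon$; $c(x,a)-T_\gamma^*u(x,a)\ge-\varepsilon$ for all $(x,a)\in\mathcal X\times\mathcal A$; and $\int_{\mathcal X\times\mathcal A}(c-T_\gamma^*u)(x,a)\,d(x,a)=1$. Its optimal solution is denoted $(\tilde\varepsilon,\tilde\alpha,\tilde\beta)$.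
   Formalization: The formal theorem adds the hypothesis that the integral of c*−T*_γ u* over X×A is at least 1; without it the claim fails, e.g. for c*=0, where ε_approx=0 but (IP) forces ε̃>0. It also assumes d>0, so that the threshold on θ is defined. *)

theory Defs
  imports "HOL-Probability.Probability"
begin

section \<open>Lipschitz norms\<close>

text \<open>
  Functions on a subset \<open>S\<close> of a type are total functions of which only the values on \<open>S\<close> matter.
  The norms take values in \<^typ>\<open>ennreal\<close>, hence are defined (possibly \<open>\<infinity>\<close>) for every function; the
  metric \<open>\<rho>\<close> is a parameter because the metric on state-action pairs is not the \<^const>\<open>dist\<close> of
  the product type.
\<close>

definition sup_norm :: "'p set \<Rightarrow> ('p \<Rightarrow> real) \<Rightarrow> ennreal" where
  "sup_norm S f = (SUP p\<in>S. ennreal \<bar>f p\<bar>)"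

definition lip_seminorm :: "('p \<Rightarrow> 'p \<Rightarrow> real) \<Rightarrow> 'p set \<Rightarrow> ('p \<Rightarrow> real) \<Rightarrow> ennreal" where
  "lip_seminorm \<rho> S f = (SUP (p, q)\<in>{(p, q). p \<in> S \<and> q \<in> S \<and> p \<noteq> q}. ennreal (\<bar>f p - f q\<bar> / \<rho> p q))"

definition lip_norm :: "('p \<Rightarrow> 'p \<Rightarrow> real) \<Rightarrow> 'p set \<Rightarrow> ('p \<Rightarrow> real) \<Rightarrow> ennreal" where
  "lip_norm \<rho> S f = sup_norm S f + lip_seminorm \<rho> S f"

definition Lip :: "('p \<Rightarrow> 'p \<Rightarrow> real) \<Rightarrow> 'p set \<Rightarrow> ('p \<Rightarrow> real) set" where
  "Lip \<rho> S = {f. lip_norm \<rho> S f < \<infinity>}"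

definition sum_dist :: "'x::real_normed_vector \<times> 'a::real_normed_vector \<Rightarrow> 'x \<times> 'a \<Rightarrow> real" where
  "sum_dist p q = norm (fst p - fst q) + norm (snd p - snd q)"

definition lin_comb :: "nat \<Rightarrow> (nat \<Rightarrow> real) \<Rightarrow> (nat \<Rightarrow> 'p \<Rightarrow> real) \<Rightarrow> 'p \<Rightarrow> real" where
  "lin_comb n \<alpha> f = (\<lambda>p. \<Sum>i=1..n. \<alpha> i * f i p)"

definition lin_indep_on :: "'p set \<Rightarrow> nat \<Rightarrow> (nat \<Rightarrow> 'p \<Rightarrow> real) \<Rightarrow> bool" where
  "lin_indep_on S n f \<longleftrightarrow>
     (\<forall>\<alpha>. (\<forall>p\<in>S. lin_comb n \<alpha> f p = 0) \<longrightarrow> (\<forall>i\<in>{1..n}. \<alpha> i = 0))"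

definition l1_ball :: "nat \<Rightarrow> real \<Rightarrow> (nat \<Rightarrow> real) set" where
  "l1_ball n \<theta> = {\<alpha>. (\<Sum>i=1..n. \<bar>\<alpha> i\<bar>) \<le> \<theta>}"

definition fun_class :: "nat \<Rightarrow> real \<Rightarrow> (nat \<Rightarrow> 'p \<Rightarrow> real) \<Rightarrow> ('p \<Rightarrow> real) set" where
  "fun_class n \<theta> f = (\<lambda>\<alpha>. lin_comb n \<alpha> f) ` l1_ball n \<theta>"


section \<open>Markov decision processes\<close>

record ('x, 'a) mdp =
  States :: "'x set"
  Actions :: "'a set"
  Trans :: "'x \<times> 'a \<Rightarrow> 'x measure"
  disc :: real
  init :: "'x measure"

abbreviation borel_on :: "'p::topological_space set \<Rightarrow> 'p measure" where
  "borel_on S \<equiv> restrict_space borel S"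

definition SA :: "('x::euclidean_space, 'a::euclidean_space) mdp \<Rightarrow> ('x \<times> 'a) measure" where
  "SA M = borel_on (States M) \<Otimes>\<^sub>M borel_on (Actions M)"

definition is_mdp :: "('x::euclidean_space, 'a::euclidean_space) mdp \<Rightarrow> bool" where
  "is_mdp M \<longleftrightarrow>
     States M \<in> sets borel \<and> Actions M \<in> sets borel \<and>
     Trans M \<in> SA M \<rightarrow>\<^sub>M prob_algebra (borel_on (States M)) \<and>
     0 < disc M \<and> disc M < 1 \<and>
     init M \<in> space (prob_algebra (borel_on (States M)))"

text \<open>
  A policy maps the time \<open>t\<close>, the history \<open>h = (x\<^sub>s, a\<^sub>s)\<^bsub>s<t\<^esub>\<close> and the current state \<open>x\<^sub>t\<close> to the
  distribution of \<open>a\<^sub>t\<close>.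
\<close>

type_synonym ('x, 'a) policy = "nat \<Rightarrow> (nat \<Rightarrow> 'x \<times> 'a) \<Rightarrow> 'x \<Rightarrow> 'a measure"

definition policies :: "('x::euclidean_space, 'a::euclidean_space) mdp \<Rightarrow> ('x, 'a) policy set" where
  "policies M = {\<pi>. \<forall>t. (\<lambda>(h, x). \<pi> t h x)
     \<in> (Pi\<^sub>M {0..<t} (\<lambda>_. SA M) \<Otimes>\<^sub>M borel_on (States M)) \<rightarrow>\<^sub>M prob_algebra (borel_on (Actions M))}"

definition stationary_policies :: "('x::euclidean_space, 'a::euclidean_space) mdp \<Rightarrow> ('x, 'a) policy set" where
  "stationary_policies M =
     (\<lambda>\<phi> t h x. \<phi> x) ` (borel_on (States M) \<rightarrow>\<^sub>M prob_algebra (borel_on (Actions M)))"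

text \<open>
  The conditional law of \<open>(x\<^sub>t, a\<^sub>t)\<close> given the history, and the law of the whole trajectory as the
  Ionescu-Tulcea projective limit of these kernels.
\<close>

definition step_kernel :: "('x::euclidean_space, 'a::euclidean_space) mdp \<Rightarrow> ('x, 'a) policy \<Rightarrow> 'x measure
    \<Rightarrow> nat \<Rightarrow> (nat \<Rightarrow> 'x \<times> 'a) \<Rightarrow> ('x \<times> 'a) measure" where
  "step_kernel M \<pi> \<nu> t h =
     (if t = 0 then \<nu> else Trans M (h (t - 1))) \<bind> (\<lambda>x. \<pi> t h x \<bind> (\<lambda>a. return (SA M) (x, a)))"

definition trajectory :: "('x::euclidean_space, 'a::euclidean_space) mdp \<Rightarrow> ('x, 'a) policy \<Rightarrow> 'x measure
    \<Rightarrow> (nat \<Rightarrow> 'x \<times> 'a) measure" where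
  "trajectory M \<pi> \<nu> =
     projective_family.lim UNIV (Ionescu_Tulcea.CI (step_kernel M \<pi> \<nu>) (\<lambda>_. SA M)) (\<lambda>_. SA M)"

definition policy_value :: "('x::euclidean_space, 'a::euclidean_space) mdp \<Rightarrow> ('x \<times> 'a \<Rightarrow> real)
    \<Rightarrow> ('x, 'a) policy \<Rightarrow> 'x measure \<Rightarrow> real" where
  "policy_value M c \<pi> \<nu> = (LINT \<omega>|trajectory M \<pi> \<nu>. (\<Sum>t. disc M ^ t * c (\<omega> t)))"

definition opt_value :: "('x::euclidean_space, 'a::euclidean_space) mdp \<Rightarrow> ('x \<times> 'a \<Rightarrow> real)
    \<Rightarrow> 'x measure \<Rightarrow> real" where
  "opt_value M c \<nu> = (INF \<pi>\<in>stationary_policies M. policy_value M c \<pi> \<nu>)"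

definition opt_value_fun :: "('x::euclidean_space, 'a::euclidean_space) mdp \<Rightarrow> ('x \<times> 'a \<Rightarrow> real)
    \<Rightarrow> 'x \<Rightarrow> real" where
  "opt_value_fun M c x = opt_value M c (return (borel_on (States M)) x)"

definition optimal_policy :: "('x::euclidean_space, 'a::euclidean_space) mdp \<Rightarrow> ('x \<times> 'a \<Rightarrow> real)
    \<Rightarrow> ('x, 'a) policy \<Rightarrow> bool" where
  "optimal_policy M c \<pi> \<longleftrightarrow> \<pi> \<in> policies M \<and> policy_value M c \<pi> (init M) = opt_value M c (init M)"

definition occupancy :: "('x::euclidean_space, 'a::euclidean_space) mdp \<Rightarrow> ('x, 'a) policy
    \<Rightarrow> ('x \<times> 'a) measure" where
  "occupancy M \<pi> = measure_of (space (SA M)) (sets (SA M))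
     (\<lambda>E. \<Sum>t. ennreal (disc M ^ t) *
        emeasure (trajectory M \<pi> (init M)) {\<omega> \<in> space (trajectory M \<pi> (init M)). \<omega> t \<in> E})"

definition P_op :: "('x, 'a) mdp \<Rightarrow> ('x \<Rightarrow> real) \<Rightarrow> 'x \<times> 'a \<Rightarrow> real" where
  "P_op M u p = (LINT y|Trans M p. u y)"

definition T_adj :: "('x, 'a) mdp \<Rightarrow> ('x \<Rightarrow> real) \<Rightarrow> 'x \<times> 'a \<Rightarrow> real" where
  "T_adj M u p = u (fst p) - disc M * P_op M u p"

definition lipschitz_control_model :: "('x::euclidean_space, 'a::euclidean_space) mdp \<Rightarrow> real
    \<Rightarrow> ('x \<times> 'a \<Rightarrow> real) \<Rightarrow> bool" where
  "lipschitz_control_model M L\<^sub>P c \<longleftrightarrow>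
     compact (States M) \<and> compact (Actions M) \<and>
     (\<forall>u. continuous_on (States M) u \<longrightarrow> continuous_on (States M \<times> Actions M) (P_op M u)) \<and>
     0 < L\<^sub>P \<and>
     (\<forall>u\<in>Lip dist (States M). \<forall>p\<in>States M \<times> Actions M. \<forall>q\<in>States M \<times> Actions M.
        \<bar>P_op M u p - P_op M u q\<bar> \<le> L\<^sub>P * enn2real (lip_seminorm dist (States M) u) * sum_dist p q) \<and>
     c \<in> Lip sum_dist (States M \<times> Actions M)"


section \<open>The inverse program\<close>

definition leb_SA :: "('x::euclidean_space, 'a::euclidean_space) mdp \<Rightarrow> real" where
  "leb_SA M = measure lborel (States M \<times> Actions M)"

definition leb_integral_SA :: "('x::euclidean_space, 'a::euclidean_space) mdp
    \<Rightarrow> ('x \<times> 'a \<Rightarrow> real) \<Rightarrow> real" where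
  "leb_integral_SA M f = (LINT p:States M \<times> Actions M|lborel. f p)"

definition IP_feasible :: "('x::euclidean_space, 'a::euclidean_space) mdp \<Rightarrow> ('x, 'a) policy \<Rightarrow> real
    \<Rightarrow> nat \<Rightarrow> (nat \<Rightarrow> 'x \<times> 'a \<Rightarrow> real) \<Rightarrow> nat \<Rightarrow> (nat \<Rightarrow> 'x \<Rightarrow> real)
    \<Rightarrow> ((nat \<Rightarrow> real) \<times> (nat \<Rightarrow> real) \<times> real) set" where
  "IP_feasible M \<pi>\<^sub>E \<theta> nc c nu u = {(\<alpha>, \<beta>, \<epsilon>).
     \<alpha> \<in> l1_ball nc \<theta> \<and> \<beta> \<in> l1_ball nu \<theta> \<and> 0 \<le> \<epsilon> \<and>
     (let f = (\<lambda>p. lin_comb nc \<alpha> c p - T_adj M (lin_comb nu \<beta> u) p) in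
        (LINT p|occupancy M \<pi>\<^sub>E. f p) \<le> \<epsilon> \<and>
        (\<forall>p\<in>States M \<times> Actions M. - \<epsilon> \<le> f p) \<and>
        leb_integral_SA M f = 1)}"

text \<open>The optimal value is \<open>\<infinity>\<close> if the program is infeasible.\<close>

definition IP_value :: "('x::euclidean_space, 'a::euclidean_space) mdp \<Rightarrow> ('x, 'a) policy \<Rightarrow> real
    \<Rightarrow> nat \<Rightarrow> (nat \<Rightarrow> 'x \<times> 'a \<Rightarrow> real) \<Rightarrow> nat \<Rightarrow> (nat \<Rightarrow> 'x \<Rightarrow> real) \<Rightarrow> ennreal" where
  "IP_value M \<pi>\<^sub>E \<theta> nc c nu u = (INF (\<alpha>, \<beta>, \<epsilon>)\<in>IP_feasible M \<pi>\<^sub>E \<theta> nc c nu u. ennreal \<epsilon>)"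

definition K_inf :: "'p set \<Rightarrow> nat \<Rightarrow> (nat \<Rightarrow> 'p \<Rightarrow> real) \<Rightarrow> real" where
  "K_inf S n f = Max ((\<lambda>i. enn2real (sup_norm S (f i))) ` {1..n})"

definition D_const :: "('x::euclidean_space, 'a::euclidean_space) mdp \<Rightarrow> real
    \<Rightarrow> nat \<Rightarrow> (nat \<Rightarrow> 'x \<times> 'a \<Rightarrow> real) \<Rightarrow> nat \<Rightarrow> (nat \<Rightarrow> 'x \<Rightarrow> real) \<Rightarrow> real" where
  "D_const M \<theta> nc c nu u =
     2 * \<theta> * (K_inf (States M \<times> Actions M) nc c + K_inf (States M) nu u) /
     ((1 - disc M)\<^sup>2 * min 1 (leb_SA M) * \<theta> + disc M - 1)"

text \<open>
  The infima below are minima over the compact coefficient balls. The bound is \<open>\<infinity>\<close> if \<open>u'\<close> is not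
  Lipschitz on the state space; the real prefactor is positive whenever
  \<open>\<theta> > 1 / ((1 - disc M) * min 1 (leb_SA M))\<close> and \<open>leb_SA M > 0\<close>.
\<close>

definition eps_approx :: "('x::euclidean_space, 'a::euclidean_space) mdp \<Rightarrow> real \<Rightarrow> real
    \<Rightarrow> nat \<Rightarrow> (nat \<Rightarrow> 'x \<times> 'a \<Rightarrow> real) \<Rightarrow> nat \<Rightarrow> (nat \<Rightarrow> 'x \<Rightarrow> real)
    \<Rightarrow> ('x \<times> 'a \<Rightarrow> real) \<Rightarrow> ('x \<Rightarrow> real) \<Rightarrow> ennreal" where
  "eps_approx M L\<^sub>P \<theta> nc c nu u c' u' =
     ennreal ((2 - disc M) / (1 - disc M)
        + D_const M \<theta> nc c nu u * (2 + disc M) * Max {1, L\<^sub>P, leb_SA M}) *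
     ((INF g\<in>fun_class nc \<theta> c. lip_norm sum_dist (States M \<times> Actions M) (\<lambda>p. c' p - g p)) +
      (INF v\<in>fun_class nu \<theta> u. lip_norm dist (States M) (\<lambda>x. u' x - v x)))"

end

theory Submission
  imports Defs
begin

text \<open>
  Write \<open>\<gamma>\<close> for the discount factor, \<open>T*\<close> for \<^const>\<open>T_adj\<close>, \<open>\<mu>\<close> for the occupancy measure of the
  expert, \<open>\<nu>\<^sub>0\<close> for the initial law and \<open>d\<close> for the Lebesgue measure of the state-action set.
  The pair \<open>(c*, u*)\<close> of true cost and optimal value function would solve the inverse program with
  \<open>\<epsilon> = 0\<close> up to normalization: the gap \<open>f* = c* - T* u*\<close> is nonnegative, \<open>\<langle>\<mu>, f*\<rangle> = 0\<close>, and its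
  Lebesgue integral is at least 1. A nearby pair \<open>(c, u)\<close> from the two classes almost inherits these
  properties and is repaired by an explicit mixture.

  \<^item> \<^emph>\<open>The gap of the optimal value function\<close> (\<open>optimal_value_function\<close>). Value iteration gives a
    continuous fixed point \<open>w\<close> of the Bellman operator. For every policy and every initial law \<open>\<nu>\<close>,
    the discounted expectation of \<open>T* w\<close> is \<open>\<langle>\<nu>, w\<rangle>\<close> (\<open>policy_value_T_adj\<close>, a telescoping sum); since
    \<open>c* - T* w\<close> is nonnegative, no policy has a value below \<open>\<langle>\<nu>, w\<rangle>\<close>. Compactness yields, without
    a measurable selection theorem, a near-greedy measurable action rule with finitely many values
    (\<open>near_greedy_selector\<close>), so stationary policies come arbitrarily close. Hence the optimal value
    is \<open>\<langle>\<nu>, w\<rangle>\<close>. Point masses give \<open>u* = w\<close> on the state space, and \<open>\<nu> = \<nu>\<^sub>0\<close> gives \<open>\<langle>\<mu>, f*\<rangle> = 0\<close>.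

  \<^item> \<^emph>\<open>Approximation\<close> (\<open>approximate_gap\<close>). If \<open>c\<close> and \<open>u\<close> are within \<open>e\<^sub>1\<close> and \<open>e\<^sub>2\<close> of \<open>c*\<close> and \<open>u*\<close>
    in the supremum norm, then \<open>f = c - T* u\<close> satisfies \<open>\<bar>f - f*\<bar> \<le> e\<^sub>1 + (1 + \<gamma>) e\<^sub>2\<close> and
    \<open>\<langle>\<mu>, f\<rangle> \<le> e\<^sub>1 / (1 - \<gamma>) + e\<^sub>2\<close>. Both constants are at most
    \<open>\<epsilon> = (2 - \<gamma>) / (1 - \<gamma>) * (e\<^sub>1 + e\<^sub>2)\<close>.

  \<^item> \<^emph>\<open>Normalization\<close> (\<open>mixing_weights\<close>, \<open>scaled_shifted_feasible\<close>). Because \<open>u\<^sub>1 = 1\<close>, adding \<open>- s\<close> to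
    the first coefficient of \<open>u\<close> adds the constant \<open>s (1 - \<gamma>)\<close> to \<open>f\<close>. If the integral of \<open>f\<close> is at
    least 1, scaling down suffices. Otherwise it is \<open>1 - \<eta>\<close> with \<open>\<eta> \<le> d (e\<^sub>1 + (1 + \<gamma>) e\<^sub>2)\<close>, and \<open>f\<close> is
    mixed with the constant \<open>\<theta> (1 - \<gamma>)\<close>, whose integral exceeds 1 by the assumption on \<open>\<theta>\<close>. The
    mixture stays in the coefficient balls and raises \<open>\<epsilon>\<close> by at most
    \<open>\<theta> \<eta> / ((1 - \<gamma>) min {1, d} \<theta> - 1)\<close>. As the supremum norm of \<open>u\<^sub>1\<close> is 1, this is
    dominated by the term of \<^const>\<open>eps_approx\<close> that contains \<^const>\<open>D_const\<close>.
\<close>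

section \<open>Lipschitz norms, infima and continuous functions\<close>

lemma sup_norm_le_lip_norm: "sup_norm X f \<le> lip_norm \<rho> X f"
  by (simp add: lip_norm_def)

lemma abs_le_sup_norm:
  assumes "sup_norm X f < \<infinity>" "x \<in> X"
  shows "\<bar>f x\<bar> \<le> enn2real (sup_norm X f)"
proof -
  have "ennreal \<bar>f x\<bar> \<le> sup_norm X f" unfolding sup_norm_def using assms(2) by (rule SUP_upper)
  then have "enn2real (ennreal \<bar>f x\<bar>) \<le> enn2real (sup_norm X f)"
    using assms(1) by (intro enn2real_mono) auto
  then show ?thesis by simp
qed

lemma abs_le_lip_norm:
  assumes "lip_norm \<rho> X f < \<infinity>" "x \<in> X"
  shows "\<bar>f x\<bar> \<le> enn2real (lip_norm \<rho> X f)"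
proof -
  have "sup_norm X f < \<infinity>" using assms(1) sup_norm_le_lip_norm by (rule le_less_trans[rotated])
  then have "\<bar>f x\<bar> \<le> enn2real (sup_norm X f)" using assms(2) by (rule abs_le_sup_norm)
  also have "\<dots> \<le> enn2real (lip_norm \<rho> X f)"
    using assms(1) by (intro enn2real_mono sup_norm_le_lip_norm) auto
  finally show ?thesis .
qed

lemma Lip_continuous:
  fixes f :: "'b::metric_space \<Rightarrow> real"
  assumes f: "f \<in> Lip \<rho> X"
    and pos: "\<And>x y. x \<in> X \<Longrightarrow> y \<in> X \<Longrightarrow> x \<noteq> y \<Longrightarrow> 0 < \<rho> x y"
    and le: "\<And>x y. x \<in> X \<Longrightarrow> y \<in> X \<Longrightarrow> \<rho> x y \<le> K * dist x y" and K: "0 \<le> K"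
  shows "continuous_on X f"
proof -
  let ?L = "enn2real (lip_seminorm \<rho> X f)"
  have fin: "lip_seminorm \<rho> X f < \<infinity>"
    using f by (auto simp: Lip_def lip_norm_def)
  have "(?L * K)-lipschitz_on X f"
  proof (rule lipschitz_onI)
    fix x y assume xy: "x \<in> X" "y \<in> X"
    show "dist (f x) (f y) \<le> ?L * K * dist x y"
    proof (cases "x = y")
      case False
      have "ennreal (\<bar>f x - f y\<bar> / \<rho> x y) \<le> lip_seminorm \<rho> X f"
        unfolding lip_seminorm_def using xy False by (auto intro!: SUP_upper2[of "(x, y)"])
      then have "enn2real (ennreal (\<bar>f x - f y\<bar> / \<rho> x y)) \<le> ?L"
        using fin by (intro enn2real_mono) auto
      then have "\<bar>f x - f y\<bar> / \<rho> x y \<le> ?L"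
        using pos[OF xy False] by simp
      then have "\<bar>f x - f y\<bar> \<le> ?L * \<rho> x y"
        using pos[OF xy False] by (simp add: pos_divide_le_eq)
      also have "\<dots> \<le> ?L * (K * dist x y)"
        by (intro mult_left_mono le xy) auto
      finally show ?thesis by (simp add: dist_real_def mult.assoc)
    qed simp
  qed (simp add: K)
  then show ?thesis by (rule lipschitz_on_continuous_on)
qed

lemma Lip_dist_continuous:
  assumes "f \<in> Lip dist X"
  shows "continuous_on X f"
  by (rule Lip_continuous[OF assms, where K = 1]) auto

lemma Lip_sum_dist_continuous:
  fixes f :: "'x::real_normed_vector \<times> 'a::real_normed_vector \<Rightarrow> real"
  assumes "f \<in> Lip sum_dist X"
  shows "continuous_on X f"
proof (rule Lip_continuous[OF assms, where K = 2])
  fix p q :: "'x \<times> 'a"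
  show "0 < sum_dist p q" if "p \<noteq> q"
    using that by (auto simp: sum_dist_def prod_eq_iff add_pos_nonneg add_nonneg_pos)
  have "sum_dist p q \<le> norm (p - q) + norm (p - q)"
    unfolding sum_dist_def
    by (intro add_mono) (metis fst_diff norm_fst_le prod.collapse, metis snd_diff norm_snd_le prod.collapse)
  then show "sum_dist p q \<le> 2 * dist p q" by (simp add: dist_norm)
qed simp

lemma continuous_lin_comb:
  assumes "\<And>i. i \<in> {1..n} \<Longrightarrow> continuous_on X (f i)"
  shows "continuous_on X (lin_comb n \<alpha> f)"
  unfolding lin_comb_def by (intro continuous_intros assms)

lemma compact_continuous_bounded:
  fixes f :: "'b::metric_space \<Rightarrow> real"
  assumes "compact K" "continuous_on K f"
  obtains B where "0 \<le> B" "\<And>x. x \<in> K \<Longrightarrow> \<bar>f x\<bar> \<le> B"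
proof -
  have "bounded (f ` K)" using assms by (intro compact_imp_bounded compact_continuous_image)
  then obtain B where "\<forall>x\<in>K. \<bar>f x\<bar> \<le> B" by (auto simp: bounded_iff)
  then have "\<And>x. x \<in> K \<Longrightarrow> \<bar>f x\<bar> \<le> max 0 B" by (auto intro: le_max_iff_disj[THEN iffD2])
  then show ?thesis using that[of "max 0 B"] by auto
qed

lemma abs_INF_diff_le:
  fixes f g :: "'b \<Rightarrow> real"
  assumes ne: "I \<noteq> {}" and d: "\<And>i. i \<in> I \<Longrightarrow> \<bar>f i - g i\<bar> \<le> e"
    and bf: "bdd_below (f ` I)" and bg: "bdd_below (g ` I)"
  shows "\<bar>(INF i\<in>I. f i) - (INF i\<in>I. g i)\<bar> \<le> e"
proof -
  have "(INF i\<in>I. f i) - e \<le> (INF i\<in>I. g i)"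
  proof (rule cINF_greatest[OF ne])
    fix i assume "i \<in> I"
    then show "(INF i\<in>I. f i) - e \<le> g i" using cINF_lower[OF bf, of i] d[of i] by auto
  qed
  moreover have "(INF i\<in>I. g i) - e \<le> (INF i\<in>I. f i)"
  proof (rule cINF_greatest[OF ne])
    fix i assume "i \<in> I"
    then show "(INF i\<in>I. g i) - e \<le> f i" using cINF_lower[OF bg, of i] d[of i] by auto
  qed
  ultimately show ?thesis by auto
qed

text \<open>
  This passes from a bound for each pair of approximants to the two best approximation errors, so
  that minimizers are not needed.
\<close>
lemma le_mult_INF_add_INF:
  fixes F :: "'b \<Rightarrow> ennreal" and H :: "'c \<Rightarrow> ennreal"
  assumes K: "0 < K" and le: "\<And>g v. g \<in> G \<Longrightarrow> v \<in> V \<Longrightarrow> a \<le> ennreal K * (F g + H v)"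
  shows "a \<le> ennreal K * ((INF g\<in>G. F g) + (INF v\<in>V. H v))"
proof (rule ennreal_le_epsilon)
  fix e :: real
  assume fin: "ennreal K * ((INF g\<in>G. F g) + (INF v\<in>V. H v)) < top" and e: "0 < e"
  define d where "d = e / K / 2"
  have d: "0 < d" using e K by (simp add: d_def)
  define f h where "f = (INF g\<in>G. F g)" and "h = (INF v\<in>V. H v)"
  have "f < top" "h < top"
    using fin K by (auto simp: ennreal_mult_less_top simp flip: f_def h_def)
  moreover have "y < y + ennreal d" if "y < top" for y
    using that d ennreal_add_left_cancel_less[of y 0 "ennreal d"] by simp
  ultimately have "(INF g\<in>G. F g) < f + ennreal d" "(INF v\<in>V. H v) < h + ennreal d"
    by (simp_all only: flip: f_def h_def)
  then obtain g v where g: "g \<in> G" "F g < f + ennreal d" and v: "v \<in> V" "H v < h + ennreal d"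
    unfolding INF_less_iff by blast
  have "a \<le> ennreal K * (F g + H v)" by (rule le[OF g(1) v(1)])
  also have "\<dots> \<le> ennreal K * ((f + ennreal d) + (h + ennreal d))"
    using g(2) v(2) by (intro mult_left_mono add_mono) (auto intro: less_imp_le)
  also have "\<dots> = ennreal K * (f + h) + ennreal K * (ennreal d + ennreal d)"
    by (simp add: distrib_left ac_simps)
  also have "ennreal K * (ennreal d + ennreal d) = ennreal e"
    using K d by (simp add: d_def flip: ennreal_plus ennreal_mult)
  finally show "a \<le> ennreal K * ((INF g\<in>G. F g) + (INF v\<in>V. H v)) + ennreal e"
    by (simp only: f_def h_def)
qed

section \<open>Kernels, trajectories and discounted values\<close>

lemma space_SA: "space (SA M) = States M \<times> Actions M"
  by (simp add: SA_def space_pair_measure space_restrict_space)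

text \<open>
  The state-action space carries the product of the two trace sigma-algebras, which has to be
  compared with the trace of the Borel sets of the product type.
\<close>
lemma continuous_measurable_SA:
  assumes "continuous_on (States M \<times> Actions M) (f :: _ \<Rightarrow> real)"
  shows "f \<in> borel_measurable (SA M)"
proof -
  have m: "fst \<in> SA M \<rightarrow>\<^sub>M borel_on (States M)" "snd \<in> SA M \<rightarrow>\<^sub>M borel_on (Actions M)"
    unfolding SA_def by measurable
  have "fst \<in> SA M \<rightarrow>\<^sub>M borel" "snd \<in> SA M \<rightarrow>\<^sub>M borel"
    using m by (auto simp: measurable_restrict_space2_iff)
  then have "(\<lambda>p. (fst p, snd p)) \<in> SA M \<rightarrow>\<^sub>M borel"
    by (rule borel_measurable_Pair)
  then have "(\<lambda>p. p) \<in> SA M \<rightarrow>\<^sub>M borel_on (States M \<times> Actions M)"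
    by (intro measurable_restrict_space2) (auto simp: space_SA)
  from measurable_compose[OF this borel_measurable_continuous_on_restrict[OF assms]]
  show ?thesis .
qed

text \<open>
  Measurable functions on the state-action space that are bounded there; nothing is required of
  their values elsewhere.
\<close>
definition bounded_measurable :: "('x::euclidean_space, 'a::euclidean_space) mdp \<Rightarrow> ('x \<times> 'a \<Rightarrow> real) \<Rightarrow> bool" where
  "bounded_measurable M f \<longleftrightarrow>
     f \<in> borel_measurable (SA M) \<and> (\<exists>B. \<forall>p\<in>States M \<times> Actions M. \<bar>f p\<bar> \<le> B)"

lemma bounded_measurable_diff:
  assumes "bounded_measurable M f" "bounded_measurable M g"
  shows "bounded_measurable M (\<lambda>p. f p - g p)"
proof -
  obtain B C where "\<forall>p\<in>States M \<times> Actions M. \<bar>f p\<bar> \<le> B" "\<forall>p\<in>States M \<times> Actions M. \<bar>g p\<bar> \<le> C"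
    using assms unfolding bounded_measurable_def by metis
  then have "\<forall>p\<in>States M \<times> Actions M. \<bar>f p - g p\<bar> \<le> B + C" by (auto intro!: order.trans[OF abs_triangle_ineq4] add_mono)
  moreover have "(\<lambda>p. f p - g p) \<in> borel_measurable (SA M)"
    using assms unfolding bounded_measurable_def by (intro borel_measurable_diff) auto
  ultimately show ?thesis unfolding bounded_measurable_def by blast
qed

lemma bounded_measurable_mult:
  assumes "bounded_measurable M f"
  shows "bounded_measurable M (\<lambda>p. r * f p)"
proof -
  obtain B where "\<forall>p\<in>States M \<times> Actions M. \<bar>f p\<bar> \<le> B"
    using assms unfolding bounded_measurable_def by metis
  then have "\<forall>p\<in>States M \<times> Actions M. \<bar>r * f p\<bar> \<le> \<bar>r\<bar> * B" by (auto simp: abs_mult intro!: mult_left_mono)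
  moreover have "(\<lambda>p. r * f p) \<in> borel_measurable (SA M)"
    using assms unfolding bounded_measurable_def by (intro borel_measurable_times) auto
  ultimately show ?thesis unfolding bounded_measurable_def by blast
qed

locale markov_decision =
  fixes M :: "('x::euclidean_space, 'a::euclidean_space) mdp"
  assumes mdp: "is_mdp M"
begin

abbreviation S :: "'x measure" where "S \<equiv> borel_on (States M)"
abbreviation A :: "'a measure" where "A \<equiv> borel_on (Actions M)"
abbreviation Hist :: "nat \<Rightarrow> (nat \<Rightarrow> 'x \<times> 'a) measure" where "Hist t \<equiv> PiM {0..<t} (\<lambda>_. SA M)"

lemma Trans_measurable [measurable]: "Trans M \<in> SA M \<rightarrow>\<^sub>M prob_algebra S"
  using mdp by (simp add: is_mdp_def)

lemma disc_bounds: "0 < disc M" "disc M < 1"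
  using mdp by (auto simp: is_mdp_def)

lemma fst_measurable: "fst \<in> SA M \<rightarrow>\<^sub>M S"
  by (simp add: SA_def)

lemma Trans_prob:
  assumes "p \<in> States M \<times> Actions M"
  shows "prob_space (Trans M p)" "sets (Trans M p) = sets S" "space (Trans M p) = States M"
proof -
  have "Trans M p \<in> space (prob_algebra S)"
    using assms by (intro measurable_space[OF Trans_measurable]) (simp add: space_SA)
  then show *: "prob_space (Trans M p)" "sets (Trans M p) = sets S"
    by (auto simp: space_prob_algebra)
  then show "space (Trans M p) = States M"
    using sets_eq_imp_space_eq[of "Trans M p" S] by (simp add: space_restrict_space)
qed

lemma P_op_integrable:
  fixes u :: "'x \<Rightarrow> real"
  assumes "p \<in> States M \<times> Actions M" and "u \<in> borel_measurable S"
    and "\<And>x. x \<in> States M \<Longrightarrow> \<bar>u x\<bar> \<le> B"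
  shows "integrable (Trans M p) u"
proof -
  interpret p: prob_space "Trans M p" by (rule Trans_prob[OF assms(1)])
  have "u \<in> borel_measurable (Trans M p)"
    using assms(2) by (simp add: measurable_cong_sets[OF Trans_prob(2)[OF assms(1)] refl])
  then show ?thesis
    by (rule p.integrable_const_bound[of _ B, rotated]) (auto simp: Trans_prob(3)[OF assms(1)] assms(3))
qed

lemma P_op_measurable:
  assumes "u \<in> borel_measurable S"
  shows "P_op M u \<in> borel_measurable (SA M)"
  unfolding P_op_def[abs_def]
  by (rule measurable_compose[OF measurable_prob_algebraD[OF Trans_measurable]
        integral_measurable_subprob_algebra[OF assms]])

lemma P_op_bound:
  assumes p: "p \<in> States M \<times> Actions M" and u: "u \<in> borel_measurable S"
    and B: "\<And>x. x \<in> States M \<Longrightarrow> \<bar>u x\<bar> \<le> B"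
  shows "\<bar>P_op M u p\<bar> \<le> B"
proof -
  interpret p: prob_space "Trans M p" by (rule Trans_prob[OF p])
  have "\<bar>P_op M u p\<bar> \<le> (LINT y|Trans M p. \<bar>u y\<bar>)" unfolding P_op_def by (rule integral_abs_bound)
  also have "\<dots> \<le> (LINT y|Trans M p. B)"
    using P_op_integrable[OF p u B] by (intro integral_mono) (auto simp: Trans_prob(3)[OF p] B)
  finally show ?thesis by (simp add: p.prob_space)
qed

lemma P_op_cong:
  assumes "p \<in> States M \<times> Actions M" and "\<And>x. x \<in> States M \<Longrightarrow> u x = v x"
  shows "P_op M u p = P_op M v p"
  unfolding P_op_def
  by (rule Bochner_Integration.integral_cong[OF refl]) (simp add: Trans_prob(3)[OF assms(1)] assms(2))

lemma P_op_linear: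
  assumes p: "p \<in> States M \<times> Actions M"
    and u: "u \<in> borel_measurable S" "\<And>x. x \<in> States M \<Longrightarrow> \<bar>u x\<bar> \<le> B"
    and v: "v \<in> borel_measurable S" "\<And>x. x \<in> States M \<Longrightarrow> \<bar>v x\<bar> \<le> C"
  shows "P_op M (\<lambda>x. r * u x + s * v x) p = r * P_op M u p + s * P_op M v p"
  unfolding P_op_def
  using P_op_integrable[OF p u] P_op_integrable[OF p v] by simp

lemma P_op_const:
  assumes "p \<in> States M \<times> Actions M"
  shows "P_op M (\<lambda>_. r) p = r"
  using prob_space.prob_space[OF Trans_prob(1)[OF assms]] by (simp add: P_op_def)

lemma T_adj_bounded_measurable:
  assumes u: "u \<in> borel_measurable S" and B: "\<And>x. x \<in> States M \<Longrightarrow> \<bar>u x\<bar> \<le> B"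
  shows "bounded_measurable M (T_adj M u)"
proof -
  have "bounded_measurable M (\<lambda>p. u (fst p))"
    unfolding bounded_measurable_def using B measurable_compose[OF fst_measurable u] by auto
  moreover have "bounded_measurable M (P_op M u)"
    unfolding bounded_measurable_def using P_op_measurable[OF u] P_op_bound[OF _ assms] by blast
  ultimately have "bounded_measurable M (\<lambda>p. u (fst p) - disc M * P_op M u p)"
    by (intro bounded_measurable_diff bounded_measurable_mult)
  then show ?thesis by (simp add: T_adj_def[abs_def])
qed

end

text \<open>A decision process that is run with a fixed policy from a fixed initial law.\<close>
locale mdp_run = markov_decision M
  for M :: "('x::euclidean_space, 'a::euclidean_space) mdp" +
  fixes \<pi> :: "('x, 'a) policy" and \<nu> :: "'x measure"
  assumes policy: "\<pi> \<in> policies M"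
    and initial: "\<nu> \<in> space (prob_algebra (borel_on (States M)))"
begin

lemma policy_measurable: "(\<lambda>(h, x). \<pi> t h x) \<in> Hist t \<Otimes>\<^sub>M S \<rightarrow>\<^sub>M prob_algebra A"
  using policy by (simp add: policies_def)

lemma policy_measurable1:
  assumes "h \<in> space (Hist t)"
  shows "\<pi> t h \<in> S \<rightarrow>\<^sub>M prob_algebra A"
  using measurable_compose[OF measurable_Pair1' policy_measurable, OF assms] by simp

text \<open>The law of the state at time \<open>t\<close> given the history, before the action is drawn.\<close>
definition state_kernel :: "nat \<Rightarrow> (nat \<Rightarrow> 'x \<times> 'a) \<Rightarrow> 'x measure" where
  "state_kernel t h = (if t = 0 then \<nu> else Trans M (h (t - 1)))"

lemma state_kernel_measurable [measurable]: "state_kernel t \<in> Hist t \<rightarrow>\<^sub>M prob_algebra S"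
proof (cases t)
  case 0
  then show ?thesis using initial by (simp add: state_kernel_def[abs_def])
next
  case (Suc n)
  have "(\<lambda>h. h n) \<in> Hist t \<rightarrow>\<^sub>M SA M"
    using Suc by (intro measurable_component_singleton) auto
  then show ?thesis using Suc
    by (simp add: state_kernel_def[abs_def])
qed

lemma action_kernel_measurable:
  "(\<lambda>(h, x). \<pi> t h x \<bind> (\<lambda>a. return (SA M) (x, a))) \<in> Hist t \<Otimes>\<^sub>M S \<rightarrow>\<^sub>M prob_algebra (SA M)"
proof -
  have "(\<lambda>y. \<pi> t (fst y) (snd y) \<bind> (\<lambda>a. return (SA M) (snd y, a)))
      \<in> Hist t \<Otimes>\<^sub>M S \<rightarrow>\<^sub>M prob_algebra (SA M)"
  proof (rule measurable_bind_prob_space2[where N = A])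
    show "(\<lambda>y. \<pi> t (fst y) (snd y)) \<in> Hist t \<Otimes>\<^sub>M S \<rightarrow>\<^sub>M prob_algebra A"
      using policy_measurable by (simp add: case_prod_beta')
    have "(\<lambda>z. (snd (fst z), snd z)) \<in> (Hist t \<Otimes>\<^sub>M S) \<Otimes>\<^sub>M A \<rightarrow>\<^sub>M SA M"
      unfolding SA_def by measurable
    from measurable_compose[OF this measurable_return_prob_space]
    show "(\<lambda>(y, a). return (SA M) (snd y, a)) \<in> (Hist t \<Otimes>\<^sub>M S) \<Otimes>\<^sub>M A \<rightarrow>\<^sub>M prob_algebra (SA M)"
      by (simp add: case_prod_beta')
  qed
  then show ?thesis by (simp add: case_prod_beta')
qed

lemma step_kernel_eq:
  "step_kernel M \<pi> \<nu> t h = state_kernel t h \<bind> (\<lambda>x. \<pi> t h x \<bind> (\<lambda>a. return (SA M) (x, a)))"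
  by (simp add: step_kernel_def state_kernel_def)

lemma step_kernel_measurable [measurable]:
  "step_kernel M \<pi> \<nu> t \<in> Hist t \<rightarrow>\<^sub>M prob_algebra (SA M)"
  unfolding step_kernel_eq[abs_def]
  by (rule measurable_bind_prob_space2[OF state_kernel_measurable action_kernel_measurable])

sublocale IT: Ionescu_Tulcea "step_kernel M \<pi> \<nu>" "\<lambda>_. SA M"
proof (rule Ionescu_Tulcea.intro)
  show "step_kernel M \<pi> \<nu> i \<in> Hist i \<rightarrow>\<^sub>M subprob_algebra (SA M)" for i
    by (rule measurable_prob_algebraD) simp
  show "x \<in> space (Hist i) \<Longrightarrow> prob_space (step_kernel M \<pi> \<nu> i x)" for i x
    using measurable_space[OF step_kernel_measurable[of i]] by (auto simp: space_prob_algebra)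
qed

abbreviation Q :: "(nat \<Rightarrow> 'x \<times> 'a) measure" where "Q \<equiv> trajectory M \<pi> \<nu>"

lemma trajectory_eq: "Q = IT.PF.lim"
  by (simp add: trajectory_def)

lemma sets_trajectory [measurable_cong, simp]: "sets Q = sets (PiM UNIV (\<lambda>_. SA M))"
  by (simp add: trajectory_eq)

lemma space_trajectory: "space Q = (\<Pi>\<^sub>E i\<in>UNIV. space (SA M))"
  by (simp add: trajectory_eq space_PiM)

lemma C_eq_CI: "IT.CI {0..<n} = IT.C 0 n (\<lambda>_. undefined)"
proof (rule measure_eqI)
  have u: "(\<lambda>_. undefined) \<in> space (Hist 0)" by (auto simp: space_PiM PiE_iff extensional_def)
  show s: "sets (IT.CI {0..<n}) = sets (IT.C 0 n (\<lambda>_. undefined))"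
    using IT.sets_C[OF u, of n] by (simp add: IT.PF.sets_P)
  fix X assume "X \<in> sets (IT.CI {0..<n})"
  then have X: "X \<in> sets (Hist n)" by (simp add: IT.PF.sets_P)
  then have "prod_emb {0..<n} (\<lambda>_. SA M) {0..<n} X = X"
    using sets.sets_into_space[OF X] by (intro prod_emb_id) (auto simp: space_PiM)
  with IT.emeasure_CI[OF _ X, of n]
  show "emeasure (IT.CI {0..<n}) X = emeasure (IT.C 0 n (\<lambda>_. undefined)) X"
    by simp
qed

text \<open>The first \<open>n\<close> steps of the trajectory have the law of the \<open>n\<close>-fold iterated kernel.\<close>
lemma distr_trajectory: "distr Q (Hist n) (\<lambda>\<omega>. restrict \<omega> {0..<n}) = IT.C 0 n (\<lambda>_. undefined)"
  using IT.distr_lim[of "{0..<n}"] by (simp add: trajectory_eq C_eq_CI)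

sublocale Q: prob_space Q
proof -
  have "prob_space (IT.C 0 0 (\<lambda>_. undefined))"
    by (rule IT.prob_space_C) (auto simp: space_PiM PiE_iff extensional_def)
  then have p: "prob_space (distr Q (Hist 0) (\<lambda>\<omega>. restrict \<omega> {0..<0}))"
    by (simp only: distr_trajectory)
  show "prob_space Q"
    by (rule prob_space_distrD[OF _ p]) (auto intro!: measurable_restrict_subset)
qed

lemma component_measurable [measurable]: "(\<lambda>\<omega>. \<omega> t) \<in> Q \<rightarrow>\<^sub>M SA M"
  by (simp add: measurable_cong_sets[OF sets_trajectory refl] measurable_component_singleton)

lemma component_in_space: "\<omega> \<in> space Q \<Longrightarrow> \<omega> t \<in> States M \<times> Actions M"
  by (auto simp: space_trajectory space_SA)

lemma restrict_measurable [measurable]: "(\<lambda>\<omega>. restrict \<omega> {0..<n}) \<in> Q \<rightarrow>\<^sub>M Hist n"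
  by (simp add: measurable_cong_sets[OF sets_trajectory refl] measurable_restrict_subset)

lemma integrable_component:
  fixes f :: "'x \<times> 'a \<Rightarrow> real"
  assumes [measurable]: "f \<in> borel_measurable (SA M)" and "\<And>p. p \<in> States M \<times> Actions M \<Longrightarrow> \<bar>f p\<bar> \<le> B"
  shows "integrable Q (\<lambda>\<omega>. f (\<omega> t))"
  by (rule Q.integrable_const_bound[where B = B]) (auto simp: assms(2) component_in_space)

text \<open>
  Conditioning on the history: the law of the \<open>t\<close>-th state-action pair is the mixture of the step
  kernels over the histories.
\<close>
lemma expectation_component:
  fixes f :: "'x \<times> 'a \<Rightarrow> real"
  assumes f [measurable]: "f \<in> borel_measurable (SA M)" and B: "\<And>p. p \<in> States M \<times> Actions M \<Longrightarrow> \<bar>f p\<bar> \<le> B"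
  shows "(LINT \<omega>|Q. f (\<omega> t)) = (LINT \<omega>|Q. LINT p|step_kernel M \<pi> \<nu> t (restrict \<omega> {0..<t}). f p)"
proof -
  let ?u = "\<lambda>_::nat. undefined :: 'x \<times> 'a"
  have u: "?u \<in> space (Hist 0)" by (auto simp: space_PiM PiE_iff extensional_def)
  have c [measurable]: "(\<lambda>\<omega>. \<omega> t) \<in> Hist (Suc t) \<rightarrow>\<^sub>M SA M"
    by (intro measurable_component_singleton) auto
  have "(LINT \<omega>|Q. f (\<omega> t)) = (LINT \<omega>|Q. f (restrict \<omega> {0..<Suc t} t))"
    by simp
  also have "\<dots> = (LINT \<omega>|distr Q (Hist (Suc t)) (\<lambda>\<omega>. restrict \<omega> {0..<Suc t}). f (\<omega> t))"
    by (rule integral_distr[symmetric]) measurable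
  also have "\<dots> = (LINT \<omega>|(IT.C 0 t ?u \<bind> IT.eP t). f (\<omega> t))"
    by (simp add: distr_trajectory)
  also have "\<dots> = (LINT h|IT.C 0 t ?u. LINT \<omega>|IT.eP t h. f (\<omega> t))"
  proof (rule integral_bind[where K = "Hist (Suc t)" and B = B and B' = 1])
    show "(\<lambda>\<omega>. f (\<omega> t)) \<in> borel_measurable (Hist (Suc t))" by measurable
    show "\<bar>f (\<omega> t)\<bar> \<le> B" if "\<omega> \<in> space (Hist (Suc t))" for \<omega>
      using measurable_space[OF c that] by (auto simp: space_SA intro!: B)
    show "IT.eP t \<in> IT.C 0 t ?u \<rightarrow>\<^sub>M subprob_algebra (Hist (Suc t))"
      using IT.measurable_eP[of t] by (simp add: measurable_cong_sets[OF IT.sets_C[OF u] refl])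
    show "finite_measure (IT.C 0 t ?u)"
      using IT.prob_space_C[OF u] by (simp add: prob_space.finite_measure)
    show "AE x in IT.C 0 t ?u. emeasure (IT.eP t x) (space (IT.eP t x)) \<le> ennreal 1"
      using IT.prob_space_eP by (auto simp: IT.space_C[OF u] prob_space.emeasure_space_1)
  qed
  also have "\<dots> = (LINT h|IT.C 0 t ?u. LINT p|step_kernel M \<pi> \<nu> t h. f p)"
  proof (rule Bochner_Integration.integral_cong[OF refl])
    fix h assume "h \<in> space (IT.C 0 t ?u)"
    then have h: "h \<in> space (Hist t)" by (simp add: IT.space_C[OF u])
    have "fun_upd h t \<in> step_kernel M \<pi> \<nu> t h \<rightarrow>\<^sub>M Hist (Suc t)"
      unfolding measurable_cong_sets[OF IT.sets_P[OF h] refl]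
      by (rule measurable_fun_upd[where J = "{0..<t}"]) (auto simp: h)
    then show "(LINT \<omega>|IT.eP t h. f (\<omega> t)) = (LINT p|step_kernel M \<pi> \<nu> t h. f p)"
      unfolding IT.eP_def by (subst integral_distr) simp_all
  qed
  also have "\<dots> = (LINT h|distr Q (Hist t) (\<lambda>\<omega>. restrict \<omega> {0..<t}). LINT p|step_kernel M \<pi> \<nu> t h. f p)"
    by (simp add: distr_trajectory)
  also have "\<dots> = (LINT \<omega>|Q. LINT p|step_kernel M \<pi> \<nu> t (restrict \<omega> {0..<t}). f p)"
    by (intro integral_distr restrict_measurable
          measurable_compose[OF measurable_prob_algebraD[OF step_kernel_measurable]
            integral_measurable_subprob_algebra[OF f]])
  finally show ?thesis .
qed

lemma integral_step_kernel:
  fixes f :: "'x \<times> 'a \<Rightarrow> real"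
  assumes f [measurable]: "f \<in> borel_measurable (SA M)" and B: "\<And>p. p \<in> States M \<times> Actions M \<Longrightarrow> \<bar>f p\<bar> \<le> B"
    and h: "h \<in> space (Hist t)"
  shows "(LINT p|step_kernel M \<pi> \<nu> t h. f p) = (LINT x|state_kernel t h. LINT a|\<pi> t h x. f (x, a))"
proof -
  have sk: "sets (state_kernel t h) = sets S" "prob_space (state_kernel t h)"
    using measurable_space[OF state_kernel_measurable h] by (auto simp: space_prob_algebra)
  have k: "(\<lambda>x. \<pi> t h x \<bind> (\<lambda>a. return (SA M) (x, a))) \<in> S \<rightarrow>\<^sub>M prob_algebra (SA M)"
    using measurable_compose[OF measurable_Pair1' action_kernel_measurable, OF h] by simp
  have "(LINT p|step_kernel M \<pi> \<nu> t h. f p)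
      = (LINT x|state_kernel t h. LINT p|(\<pi> t h x \<bind> (\<lambda>a. return (SA M) (x, a))). f p)"
    unfolding step_kernel_eq
  proof (rule integral_bind[where K = "SA M" and B = B and B' = 1])
    show "(\<lambda>x. \<pi> t h x \<bind> (\<lambda>a. return (SA M) (x, a))) \<in> state_kernel t h \<rightarrow>\<^sub>M subprob_algebra (SA M)"
      using measurable_prob_algebraD[OF k] by (simp add: measurable_cong_sets[OF sk(1) refl])
    show "AE x in state_kernel t h. emeasure (\<pi> t h x \<bind> (\<lambda>a. return (SA M) (x, a)))
         (space (\<pi> t h x \<bind> (\<lambda>a. return (SA M) (x, a)))) \<le> ennreal 1"
    proof (rule AE_I2)
      fix x assume "x \<in> space (state_kernel t h)"
      then have "x \<in> space S" using sets_eq_imp_space_eq[OF sk(1)] by simp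
      from measurable_space[OF k this]
      show "emeasure (\<pi> t h x \<bind> (\<lambda>a. return (SA M) (x, a)))
         (space (\<pi> t h x \<bind> (\<lambda>a. return (SA M) (x, a)))) \<le> ennreal 1"
        by (simp add: space_prob_algebra prob_space.emeasure_space_1)
    qed
  qed (use sk B in \<open>auto simp: space_SA prob_space.finite_measure\<close>)
  also have "\<dots> = (LINT x|state_kernel t h. LINT a|\<pi> t h x. f (x, a))"
  proof (rule Bochner_Integration.integral_cong[OF refl])
    fix x assume "x \<in> space (state_kernel t h)"
    then have x: "x \<in> space S" using sets_eq_imp_space_eq[OF sk(1)] by simp
    have pk: "sets (\<pi> t h x) = sets A" "prob_space (\<pi> t h x)"
      using measurable_space[OF policy_measurable1[OF h] x] by (auto simp: space_prob_algebra)
    have pr: "(\<lambda>a. (x, a)) \<in> A \<rightarrow>\<^sub>M SA M"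
      unfolding SA_def by (rule measurable_Pair1'[OF x])
    have r: "(\<lambda>a. return (SA M) (x, a)) \<in> A \<rightarrow>\<^sub>M prob_algebra (SA M)"
      by (rule measurable_compose[OF pr measurable_return_prob_space])
    have "(LINT p|(\<pi> t h x \<bind> (\<lambda>a. return (SA M) (x, a))). f p)
        = (LINT a|\<pi> t h x. LINT p|return (SA M) (x, a). f p)"
    proof (rule integral_bind[where K = "SA M" and B = B and B' = 1])
      show "(\<lambda>a. return (SA M) (x, a)) \<in> \<pi> t h x \<rightarrow>\<^sub>M subprob_algebra (SA M)"
        using measurable_prob_algebraD[OF r] by (simp add: measurable_cong_sets[OF pk(1) refl])
      show "AE a in \<pi> t h x. emeasure (return (SA M) (x, a)) (space (return (SA M) (x, a))) \<le> ennreal 1"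
        by (rule AE_I2) (auto simp: emeasure_return split: split_indicator)
    qed (use pk B in \<open>auto simp: space_SA prob_space.finite_measure\<close>)
    also have "\<dots> = (LINT a|\<pi> t h x. f (x, a))"
    proof (rule Bochner_Integration.integral_cong[OF refl])
      fix a assume "a \<in> space (\<pi> t h x)"
      then have "a \<in> space A" using sets_eq_imp_space_eq[OF pk(1)] by simp
      then show "(LINT p|return (SA M) (x, a). f p) = f (x, a)"
        using measurable_space[OF pr] by (intro integral_return) auto
    qed
    finally show "(LINT p|(\<pi> t h x \<bind> (\<lambda>a. return (SA M) (x, a))). f p) = (LINT a|\<pi> t h x. f (x, a))" .
  qed
  finally show ?thesis .
qed

text \<open>The expectation of \<open>f (x\<^sub>t, a\<^sub>t)\<close> along the trajectory.\<close>
abbreviation exp_at :: "nat \<Rightarrow> ('x \<times> 'a \<Rightarrow> real) \<Rightarrow> real" where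
  "exp_at t f \<equiv> LINT \<omega>|Q. f (\<omega> t)"

lemma exp_at_bound:
  assumes f: "f \<in> borel_measurable (SA M)" and B: "\<And>p. p \<in> States M \<times> Actions M \<Longrightarrow> \<bar>f p\<bar> \<le> B"
  shows "\<bar>exp_at t f\<bar> \<le> B"
proof -
  have "\<bar>exp_at t f\<bar> \<le> (LINT \<omega>|Q. \<bar>f (\<omega> t)\<bar>)" by (rule integral_abs_bound)
  also have "\<dots> \<le> (LINT \<omega>|Q. B)"
    using integrable_component[OF f B] B component_in_space by (intro integral_mono) auto
  finally show ?thesis by (simp add: Q.prob_space)
qed

lemma policy_value_sums:
  assumes "bounded_measurable M f"
  shows "(\<lambda>t. disc M ^ t * exp_at t f) sums policy_value M f \<pi> \<nu>"
proof -
  obtain B where B: "\<And>p. p \<in> States M \<times> Actions M \<Longrightarrow> \<bar>f p\<bar> \<le> B"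
    using assms unfolding bounded_measurable_def by metis
  have f [measurable]: "f \<in> borel_measurable (SA M)" using assms by (simp add: bounded_measurable_def)
  have g: "summable (\<lambda>t. disc M ^ t * B)"
    using disc_bounds by (intro summable_mult2 summable_geometric) auto
  have "(\<lambda>t. LINT \<omega>|Q. disc M ^ t * f (\<omega> t)) sums (LINT \<omega>|Q. (\<Sum>t. disc M ^ t * f (\<omega> t)))"
  proof (rule sums_integral)
    show i: "integrable Q (\<lambda>\<omega>. disc M ^ t * f (\<omega> t))" for t
      using integrable_component[OF f B] by simp
    have bd: "norm (disc M ^ t * f (\<omega> t)) \<le> disc M ^ t * B" if "\<omega> \<in> space Q" for t \<omega>
      using disc_bounds B[OF component_in_space[OF that]] by (auto simp: abs_mult intro!: mult_left_mono)
    show "AE \<omega> in Q. summable (\<lambda>t. norm (disc M ^ t * f (\<omega> t)))"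
      using bd by (intro AE_I2 summable_comparison_test'[OF g, of 0]) simp
    show "summable (\<lambda>t. LINT \<omega>|Q. norm (disc M ^ t * f (\<omega> t)))"
    proof (rule summable_comparison_test'[OF g, of 0])
      fix t
      have "(LINT \<omega>|Q. norm (disc M ^ t * f (\<omega> t))) \<le> (LINT \<omega>|Q. disc M ^ t * B)"
        using i bd by (intro integral_mono) auto
      then show "norm (LINT \<omega>|Q. norm (disc M ^ t * f (\<omega> t))) \<le> disc M ^ t * B"
        by (simp add: Q.prob_space)
    qed
  qed
  then show ?thesis by (simp add: policy_value_def)
qed

lemma policy_value_diff:
  assumes "bounded_measurable M f" "bounded_measurable M g"
  shows "policy_value M (\<lambda>p. f p - g p) \<pi> \<nu> = policy_value M f \<pi> \<nu> - policy_value M g \<pi> \<nu>"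
proof -
  obtain B C where "\<And>p. p \<in> States M \<times> Actions M \<Longrightarrow> \<bar>f p\<bar> \<le> B" "\<And>p. p \<in> States M \<times> Actions M \<Longrightarrow> \<bar>g p\<bar> \<le> C"
    using assms unfolding bounded_measurable_def by metis
  then have "exp_at t (\<lambda>p. f p - g p) = exp_at t f - exp_at t g" for t
    using assms unfolding bounded_measurable_def
    by (intro Bochner_Integration.integral_diff integrable_component) auto
  then have "(\<lambda>t. disc M ^ t * exp_at t (\<lambda>p. f p - g p)) sums (policy_value M f \<pi> \<nu> - policy_value M g \<pi> \<nu>)"
    using sums_diff[OF policy_value_sums[OF assms(1)] policy_value_sums[OF assms(2)]]
    by (simp add: right_diff_distrib)
  then show ?thesis
    using sums_unique2 policy_value_sums[OF bounded_measurable_diff[OF assms]] by blast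
qed

lemma policy_value_bounds:
  assumes "bounded_measurable M f"
  shows "(\<And>p. p \<in> States M \<times> Actions M \<Longrightarrow> f p \<le> B) \<Longrightarrow> policy_value M f \<pi> \<nu> \<le> B / (1 - disc M)"
    and "(\<And>p. p \<in> States M \<times> Actions M \<Longrightarrow> B \<le> f p) \<Longrightarrow> B / (1 - disc M) \<le> policy_value M f \<pi> \<nu>"
proof -
  obtain B' where "\<And>p. p \<in> States M \<times> Actions M \<Longrightarrow> \<bar>f p\<bar> \<le> B'"
    using assms unfolding bounded_measurable_def by metis
  then have i: "integrable Q (\<lambda>\<omega>. f (\<omega> t))" for t
    using assms unfolding bounded_measurable_def by (intro integrable_component) auto
  have g: "(\<lambda>t. disc M ^ t * B) sums (B / (1 - disc M))"
    using sums_mult2[OF geometric_sums[of "disc M"], of B] disc_bounds by simp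
  note s = policy_value_sums[OF assms]
  {
    assume "\<And>p. p \<in> States M \<times> Actions M \<Longrightarrow> f p \<le> B"
    then have "exp_at t f \<le> (LINT \<omega>|Q. B)" for t
      using i component_in_space by (intro integral_mono) auto
    then show "policy_value M f \<pi> \<nu> \<le> B / (1 - disc M)"
      using disc_bounds by (intro sums_le[OF _ s g] mult_left_mono) (auto simp: Q.prob_space)
  }
  {
    assume "\<And>p. p \<in> States M \<times> Actions M \<Longrightarrow> B \<le> f p"
    then have "(LINT \<omega>|Q. B) \<le> exp_at t f" for t
      using i component_in_space by (intro integral_mono) auto
    then show "B / (1 - disc M) \<le> policy_value M f \<pi> \<nu>"
      using disc_bounds by (intro sums_le[OF _ g s] mult_left_mono) (auto simp: Q.prob_space)
  }
qed

lemma policy_value_cong: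
  assumes "\<And>p. p \<in> States M \<times> Actions M \<Longrightarrow> f p = g p"
  shows "policy_value M f \<pi> \<nu> = policy_value M g \<pi> \<nu>"
  unfolding policy_value_def
  by (rule Bochner_Integration.integral_cong[OF refl]) (simp add: assms[OF component_in_space])

lemma policy_value_mult:
  assumes "bounded_measurable M f"
  shows "policy_value M (\<lambda>p. r * f p) \<pi> \<nu> = r * policy_value M f \<pi> \<nu>"
proof -
  have "(\<lambda>t. r * (disc M ^ t * exp_at t f)) sums (r * policy_value M f \<pi> \<nu>)"
    by (rule sums_mult[OF policy_value_sums[OF assms]])
  then have "(\<lambda>t. disc M ^ t * exp_at t (\<lambda>p. r * f p)) sums (r * policy_value M f \<pi> \<nu>)"
    by (simp add: mult.left_commute)
  from sums_unique2[OF policy_value_sums[OF bounded_measurable_mult[OF assms]] this] show ?thesis .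
qed

lemma policy_value_const: "policy_value M (\<lambda>_. r) \<pi> \<nu> = r / (1 - disc M)"
proof -
  have "bounded_measurable M (\<lambda>_. r)" by (auto simp: bounded_measurable_def)
  from policy_value_bounds[OF this, of r] show ?thesis by (intro antisym) auto
qed

lemma exp_state:
  assumes u [measurable]: "u \<in> borel_measurable S" and B: "\<And>x. x \<in> States M \<Longrightarrow> \<bar>u x\<bar> \<le> B"
  shows "exp_at t (\<lambda>p. u (fst p)) = (LINT \<omega>|Q. LINT x|state_kernel t (restrict \<omega> {0..<t}). u x)"
proof -
  have um: "(\<lambda>p. u (fst p)) \<in> borel_measurable (SA M)"
    by (rule measurable_compose[OF fst_measurable u])
  have "exp_at t (\<lambda>p. u (fst p)) = (LINT \<omega>|Q. LINT p|step_kernel M \<pi> \<nu> t (restrict \<omega> {0..<t}). u (fst p))"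
    using B by (intro expectation_component[OF um]) auto
  also have "\<dots> = (LINT \<omega>|Q. LINT x|state_kernel t (restrict \<omega> {0..<t}). u x)"
  proof (rule Bochner_Integration.integral_cong[OF refl])
    fix \<omega> assume "\<omega> \<in> space Q"
    then have h: "restrict \<omega> {0..<t} \<in> space (Hist t)" (is "?h \<in> _")
      by (rule measurable_space[OF restrict_measurable])
    have "(LINT p|step_kernel M \<pi> \<nu> t ?h. u (fst p)) = (LINT x|state_kernel t ?h. LINT a|\<pi> t ?h x. u (fst (x, a)))"
      using B by (intro integral_step_kernel[OF um _ h]) auto
    also have "\<dots> = (LINT x|state_kernel t ?h. u x)"
    proof (rule Bochner_Integration.integral_cong[OF refl])
      fix x assume "x \<in> space (state_kernel t ?h)"
      then have x: "x \<in> space S"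
        using measurable_space[OF state_kernel_measurable h] by (auto simp: space_prob_algebra dest!: sets_eq_imp_space_eq)
      then interpret p: prob_space "\<pi> t ?h x"
        using measurable_space[OF policy_measurable1[OF h] x] by (auto simp: space_prob_algebra)
      show "(LINT a|\<pi> t ?h x. u (fst (x, a))) = u x" by (simp add: p.prob_space)
    qed
    finally show "(LINT p|step_kernel M \<pi> \<nu> t ?h. u (fst p)) = (LINT x|state_kernel t ?h. u x)" .
  qed
  finally show ?thesis .
qed

lemma exp_state_0:
  assumes "u \<in> borel_measurable S" "\<And>x. x \<in> States M \<Longrightarrow> \<bar>u x\<bar> \<le> B"
  shows "exp_at 0 (\<lambda>p. u (fst p)) = (LINT x|\<nu>. u x)"
  using exp_state[OF assms, of 0] by (simp add: state_kernel_def Q.prob_space)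

lemma exp_state_Suc:
  assumes "u \<in> borel_measurable S" "\<And>x. x \<in> States M \<Longrightarrow> \<bar>u x\<bar> \<le> B"
  shows "exp_at (Suc t) (\<lambda>p. u (fst p)) = exp_at t (P_op M u)"
  using exp_state[OF assms, of "Suc t"] by (simp add: state_kernel_def P_op_def[abs_def])

text \<open>
  The adjoint relation \<open>\<langle>\<mu>, T* u\<rangle> = \<langle>\<nu>, u\<rangle>\<close> for the discounted occupancy measure \<open>\<mu>\<close>: as \<open>P u\<close> at time
  \<open>t\<close> has the expectation of \<open>u (x\<^bsub>t+1\<^esub>)\<close>, the discounted sum telescopes.
\<close>
lemma policy_value_T_adj:
  assumes u: "u \<in> borel_measurable S" and B: "\<And>x. x \<in> States M \<Longrightarrow> \<bar>u x\<bar> \<le> B"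
  shows "policy_value M (T_adj M u) \<pi> \<nu> = (LINT x|\<nu>. u x)"
proof -
  let ?e = "\<lambda>t. disc M ^ t * exp_at t (\<lambda>p. u (fst p))"
  have um: "(\<lambda>p. u (fst p)) \<in> borel_measurable (SA M)"
    by (rule measurable_compose[OF fst_measurable u])
  have split: "exp_at t (T_adj M u) = exp_at t (\<lambda>p. u (fst p)) - disc M * exp_at t (P_op M u)" for t
  proof -
    have "exp_at t (T_adj M u) = exp_at t (\<lambda>p. u (fst p)) - exp_at t (\<lambda>p. disc M * P_op M u p)"
      unfolding T_adj_def[abs_def] using B P_op_measurable[OF u] P_op_bound[OF _ assms]
      by (intro Bochner_Integration.integral_diff integrable_mult_right integrable_component um) auto
    then show ?thesis by simp
  qed
  have e: "disc M ^ t * exp_at t (T_adj M u) = ?e t - ?e (Suc t)" for t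
    using split[of t] exp_state_Suc[OF assms, of t] by (simp add: right_diff_distrib mult_ac)
  have "?e \<longlonglongrightarrow> 0"
  proof (rule Lim_null_comparison)
    show "\<forall>\<^sub>F t in sequentially. norm (?e t) \<le> disc M ^ t * B"
      using disc_bounds exp_at_bound[OF um, of B] B
      by (auto simp: abs_mult intro!: always_eventually mult_left_mono)
    show "(\<lambda>t. disc M ^ t * B) \<longlonglongrightarrow> 0"
      using disc_bounds by (intro tendsto_mult_left_zero LIMSEQ_power_zero) auto
  qed
  from telescope_sums'[OF this]
  have "(\<lambda>t. disc M ^ t * exp_at t (T_adj M u)) sums (LINT x|\<nu>. u x)"
    unfolding e by (simp add: exp_state_0[OF assms])
  then show ?thesis
    using sums_unique2 policy_value_sums[OF T_adj_bounded_measurable[OF assms]] by blast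
qed

text \<open>
  If actions are chosen by \<open>a\<^sub>t = \<phi> (x\<^sub>t)\<close>, the value only depends on the restriction of the cost to
  the graph of \<open>\<phi>\<close>.
\<close>
lemma policy_value_deterministic:
  assumes \<phi>: "\<phi> \<in> S \<rightarrow>\<^sub>M A" and det: "\<And>t h x. \<pi> t h x = return A (\<phi> x)"
    and f: "bounded_measurable M f"
  shows "policy_value M f \<pi> \<nu> = policy_value M (\<lambda>p. f (fst p, \<phi> (fst p))) \<pi> \<nu>"
    and "bounded_measurable M (\<lambda>p. f (fst p, \<phi> (fst p)))"
proof -
  let ?g = "\<lambda>p. f (fst p, \<phi> (fst p))"
  obtain B where B: "\<And>p. p \<in> States M \<times> Actions M \<Longrightarrow> \<bar>f p\<bar> \<le> B"
    using f unfolding bounded_measurable_def by metis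
  have fm: "f \<in> borel_measurable (SA M)" using f by (simp add: bounded_measurable_def)
  have pr: "(\<lambda>p. (fst p, \<phi> (fst p))) \<in> SA M \<rightarrow>\<^sub>M SA M"
    using \<phi> unfolding SA_def by measurable
  have gm: "?g \<in> borel_measurable (SA M)"
    by (rule measurable_compose[OF pr fm])
  have gB: "\<bar>?g p\<bar> \<le> B" if "p \<in> States M \<times> Actions M" for p
    using measurable_space[OF pr, of p] that B by (auto simp: space_SA)
  show g: "bounded_measurable M ?g" using gm gB unfolding bounded_measurable_def by blast
  have *: "(LINT p|step_kernel M \<pi> \<nu> t h. f p) = (LINT p|step_kernel M \<pi> \<nu> t h. ?g p)"
    if h: "h \<in> space (Hist t)" for t h
  proof -
    have "(LINT x|state_kernel t h. LINT a|\<pi> t h x. f (x, a))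
        = (LINT x|state_kernel t h. LINT a|\<pi> t h x. ?g (x, a))"
    proof (rule Bochner_Integration.integral_cong[OF refl])
      fix x assume "x \<in> space (state_kernel t h)"
      then have x: "x \<in> space S"
        using measurable_space[OF state_kernel_measurable h] by (auto simp: space_prob_algebra dest!: sets_eq_imp_space_eq)
      have "(\<lambda>a. f (x, a)) \<in> borel_measurable A"
        using measurable_compose[OF measurable_Pair1'[OF x] fm[unfolded SA_def]] .
      moreover have "\<phi> x \<in> space A" by (rule measurable_space[OF \<phi> x])
      ultimately show "(LINT a|\<pi> t h x. f (x, a)) = (LINT a|\<pi> t h x. ?g (x, a))"
        unfolding det by (subst (1 2) integral_return) auto
    qed
    then show ?thesis
      using integral_step_kernel[OF fm B h] integral_step_kernel[OF gm gB h] by simp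
  qed
  have "exp_at t f = exp_at t ?g" for t
  proof -
    have "(LINT \<omega>|Q. LINT p|step_kernel M \<pi> \<nu> t (restrict \<omega> {0..<t}). f p)
        = (LINT \<omega>|Q. LINT p|step_kernel M \<pi> \<nu> t (restrict \<omega> {0..<t}). ?g p)"
      by (rule Bochner_Integration.integral_cong[OF refl *])
        (rule measurable_space[OF restrict_measurable])
    then show ?thesis
      using expectation_component[OF fm B] expectation_component[OF gm gB] by simp
  qed
  then show "policy_value M f \<pi> \<nu> = policy_value M ?g \<pi> \<nu>"
    using policy_value_sums[OF f] policy_value_sums[OF g] sums_unique2 by simp
qed

text \<open>
  The occupancy measure is the image of the product of the geometric weights \<open>\<gamma>\<^sup>t\<close> on the times with
  the trajectory law under \<open>(t, \<omega>) \<mapsto> \<omega> t\<close>. In particular the set function in its definition is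
  countably additive, and Fubini's theorem computes its integrals.
\<close>
lemma integral_occupancy:
  assumes init: "\<nu> = init M" and f: "bounded_measurable M f"
  shows "(LINT p|occupancy M \<pi>. f p) = policy_value M f \<pi> \<nu>"
proof -
  define D where "D = density (count_space (UNIV :: nat set)) (\<lambda>t. ennreal (disc M ^ t))"
  have sD: "sets D = UNIV" "space D = UNIV" by (auto simp: D_def)
  obtain B where B: "\<And>p. p \<in> States M \<times> Actions M \<Longrightarrow> \<bar>f p\<bar> \<le> B"
    using f unfolding bounded_measurable_def by metis
  have fm: "f \<in> borel_measurable (SA M)" using f by (simp add: bounded_measurable_def)
  have eD: "emeasure D UNIV = ennreal (1 / (1 - disc M))"
  proof -
    have "emeasure D UNIV = (\<Sum>t. ennreal (disc M ^ t))"
      by (simp add: D_def emeasure_density nn_integral_count_space_nat)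
    also have "\<dots> = ennreal (1 / (1 - disc M))"
      using disc_bounds geometric_sums[of "disc M"] by (intro suminf_ennreal_eq) auto
    finally show ?thesis .
  qed
  interpret D: finite_measure D by standard (simp add: sD eD)
  interpret P: pair_sigma_finite D Q by standard
  interpret PF: finite_measure "D \<Otimes>\<^sub>M Q"
  proof
    have "emeasure (D \<Otimes>\<^sub>M Q) (space (D \<Otimes>\<^sub>M Q)) = emeasure D (space D) * emeasure Q (space Q)"
      unfolding space_pair_measure by (rule Q.emeasure_pair_measure_Times) (rule sets.top)+
    then show "emeasure (D \<Otimes>\<^sub>M Q) (space (D \<Otimes>\<^sub>M Q)) \<noteq> \<infinity>"
      by (simp add: Q.emeasure_space_1 sD eD)
  qed
  have cm: "(\<lambda>(t, \<omega>). \<omega> t) \<in> D \<Otimes>\<^sub>M Q \<rightarrow>\<^sub>M SA M"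
  proof -
    have "(\<lambda>(t, \<omega>). \<omega> t) \<in> count_space UNIV \<Otimes>\<^sub>M Q \<rightarrow>\<^sub>M SA M"
      by (rule measurable_pair_measure_countable1) auto
    moreover have "sets (D \<Otimes>\<^sub>M Q) = sets (count_space UNIV \<Otimes>\<^sub>M Q)"
      by (rule sets_pair_measure_cong) (auto simp: sD)
    ultimately show ?thesis using measurable_cong_sets[OF _ refl] by blast
  qed
  let ?N = "distr (D \<Otimes>\<^sub>M Q) (SA M) (\<lambda>(t, \<omega>). \<omega> t)"
  have "occupancy M \<pi> = measure_of (space ?N) (sets ?N) (emeasure ?N)"
    unfolding occupancy_def space_distr sets_distr
  proof (rule measure_of_eq)
    show "sets (SA M) \<subseteq> Pow (space (SA M))" by (rule sets.space_closed)
    fix E assume "E \<in> sigma_sets (space (SA M)) (sets (SA M))"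
    then have E: "E \<in> sets (SA M)" by (simp add: sets.sigma_sets_eq)
    have X: "(\<lambda>(t, \<omega>). \<omega> t) -` E \<inter> space (D \<Otimes>\<^sub>M Q) \<in> sets (D \<Otimes>\<^sub>M Q)"
      by (rule measurable_sets[OF cm E])
    have "emeasure ?N E = emeasure (D \<Otimes>\<^sub>M Q) ((\<lambda>(t, \<omega>). \<omega> t) -` E \<inter> space (D \<Otimes>\<^sub>M Q))"
      by (rule emeasure_distr[OF cm E])
    also have "\<dots> = (\<integral>\<^sup>+t. emeasure Q (Pair t -` ((\<lambda>(t, \<omega>). \<omega> t) -` E \<inter> space (D \<Otimes>\<^sub>M Q))) \<partial>D)"
      by (rule Q.emeasure_pair_measure_alt[OF X])
    also have "\<dots> = (\<integral>\<^sup>+t. emeasure Q {\<omega> \<in> space Q. \<omega> t \<in> E} \<partial>D)"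
      by (intro nn_integral_cong arg_cong[where f = "emeasure Q"]) (auto simp: space_pair_measure sD)
    also have "\<dots> = (\<Sum>t. ennreal (disc M ^ t) * emeasure Q {\<omega> \<in> space Q. \<omega> t \<in> E})"
      unfolding D_def by (subst nn_integral_density) (auto simp: nn_integral_count_space_nat)
    finally show "(\<Sum>t. ennreal (disc M ^ t) * emeasure (trajectory M \<pi> (init M))
          {\<omega> \<in> space (trajectory M \<pi> (init M)). \<omega> t \<in> E}) = emeasure ?N E"
      by (simp add: init)
  qed
  also have "\<dots> = ?N" by (rule measure_of_of_measure)
  finally have "(LINT p|occupancy M \<pi>. f p) = (LINT p|?N. f p)" by simp
  also have "\<dots> = (LINT z|(D \<Otimes>\<^sub>M Q). f (case z of (t, \<omega>) \<Rightarrow> \<omega> t))"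
    by (rule integral_distr[OF cm fm])
  also have "\<dots> = (LINT t|D. LINT \<omega>|Q. f (\<omega> t))"
  proof -
    have "integrable (D \<Otimes>\<^sub>M Q) (\<lambda>z. f (case z of (t, \<omega>) \<Rightarrow> \<omega> t))"
      by (rule PF.integrable_const_bound[of _ B, OF _ measurable_compose[OF cm fm]])
        (auto intro!: AE_I2 B component_in_space simp: space_pair_measure)
    then show ?thesis by (subst P.integral_fst'[symmetric]) auto
  qed
  also have "\<dots> = (LINT t|count_space UNIV. disc M ^ t * exp_at t f)"
    unfolding D_def using disc_bounds by (subst integral_density) auto
  also have "\<dots> = (\<Sum>t. disc M ^ t * exp_at t f)"
  proof (rule integral_count_space_nat, unfold integrable_count_space_nat_iff)
    show "summable (\<lambda>t. norm (disc M ^ t * exp_at t f))"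
    proof (rule summable_comparison_test'[of "\<lambda>t. disc M ^ t * B" 0])
      show "summable (\<lambda>t. disc M ^ t * B)"
        using disc_bounds by (intro summable_mult2 summable_geometric) auto
      show "norm (norm (disc M ^ t * exp_at t f)) \<le> disc M ^ t * B" for t
        using disc_bounds exp_at_bound[OF fm B, of t] by (auto simp: abs_mult intro!: mult_left_mono)
    qed
  qed
  also have "\<dots> = policy_value M f \<pi> \<nu>"
    using policy_value_sums[OF f] by (simp add: sums_iff)
  finally show ?thesis .
qed

end

section \<open>The optimal value function as a fixed point\<close>

text \<open>
  A compact decision process with continuous cost and a weakly continuous transition law; the
  quantitative Lipschitz bounds are not part of it.
\<close>
locale control_model = markov_decision M
  for M :: "('x::euclidean_space, 'a::euclidean_space) mdp" +
  fixes c :: "'x \<times> 'a \<Rightarrow> real"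
  assumes compact_states: "compact (States M)" and compact_actions: "compact (Actions M)"
    and actions_nonempty: "Actions M \<noteq> {}"
    and weakly_continuous: "continuous_on (States M) u \<Longrightarrow> continuous_on (States M \<times> Actions M) (P_op M u)"
    and cost_continuous: "continuous_on (States M \<times> Actions M) c"
begin

lemma compact_SA: "compact (States M \<times> Actions M)"
  by (rule compact_Times[OF compact_states compact_actions])

lemma continuous_bounded_measurable:
  assumes "continuous_on (States M \<times> Actions M) f"
  shows "bounded_measurable M f"
  using compact_continuous_bounded[OF compact_SA assms] continuous_measurable_SA[OF assms]
  unfolding bounded_measurable_def by metis

lemma continuous_T_adj:
  assumes "continuous_on (States M) w"
  shows "continuous_on (States M \<times> Actions M) (T_adj M w)"
  unfolding T_adj_def[abs_def]
  by (intro continuous_intros weakly_continuous[OF assms] continuous_on_compose2[OF assms]) auto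

lemma P_op_diff_bound:
  assumes p: "p \<in> States M \<times> Actions M" and w: "continuous_on (States M) w" and v: "continuous_on (States M) v"
    and d: "\<And>x. x \<in> States M \<Longrightarrow> \<bar>w x - v x\<bar> \<le> K"
  shows "\<bar>P_op M w p - P_op M v p\<bar> \<le> K"
proof -
  obtain B where B: "\<And>x. x \<in> States M \<Longrightarrow> \<bar>w x\<bar> \<le> B" using compact_continuous_bounded[OF compact_states w] by metis
  obtain C where C: "\<And>x. x \<in> States M \<Longrightarrow> \<bar>v x\<bar> \<le> C" using compact_continuous_bounded[OF compact_states v] by metis
  note m = borel_measurable_continuous_on_restrict[OF w] borel_measurable_continuous_on_restrict[OF v]
  have "P_op M w p - P_op M v p = P_op M (\<lambda>x. w x - v x) p"
    using P_op_linear[OF p m(1) B m(2) C, of 1 "-1"] by simp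
  then show ?thesis
    using P_op_bound[OF p borel_measurable_diff[OF m], of K] d by simp
qed

text \<open>The Bellman operator, with an infimum so that no minimizing action has to be chosen.\<close>
definition bellman :: "('x \<Rightarrow> real) \<Rightarrow> 'x \<Rightarrow> real" where
  "bellman w x = (INF a\<in>Actions M. c (x, a) + disc M * P_op M w (x, a))"

lemma continuous_backup:
  assumes "continuous_on (States M) w"
  shows "continuous_on (States M \<times> Actions M) (\<lambda>p. c p + disc M * P_op M w p)"
  by (intro continuous_intros cost_continuous weakly_continuous[OF assms])

lemma bdd_below_backup:
  assumes "continuous_on (States M) w" "x \<in> States M"
  shows "bdd_below ((\<lambda>a. c (x, a) + disc M * P_op M w (x, a)) ` Actions M)"
proof -
  obtain B where B: "\<And>p. p \<in> States M \<times> Actions M \<Longrightarrow> \<bar>c p + disc M * P_op M w p\<bar> \<le> B"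
    using compact_continuous_bounded[OF compact_SA continuous_backup[OF assms(1)]] by metis
  show ?thesis
    using assms(2) B by (intro bdd_belowI2[of _ "- B"]) (force simp: abs_le_iff)
qed

lemma continuous_bellman:
  assumes w: "continuous_on (States M) w"
  shows "continuous_on (States M) (bellman w)"
proof (clarsimp simp: continuous_on_iff)
  fix x e :: real and x0 assume x: "x0 \<in> States M" and e: "0 < e"
  let ?g = "\<lambda>p. c p + disc M * P_op M w p"
  have "uniformly_continuous_on (States M \<times> Actions M) ?g"
    by (rule compact_uniformly_continuous[OF continuous_backup[OF w] compact_SA])
  then obtain d where d: "d > 0" "\<And>p q. p \<in> States M \<times> Actions M \<Longrightarrow> q \<in> States M \<times> Actions M \<Longrightarrow>
      dist q p < d \<Longrightarrow> dist (?g q) (?g p) < e / 2"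
    unfolding uniformly_continuous_on_def using e half_gt_zero by metis
  show "\<exists>d>0. \<forall>x'\<in>States M. dist x' x0 < d \<longrightarrow> dist (bellman w x') (bellman w x0) < e"
  proof (intro exI[of _ d] conjI ballI impI)
    fix x' assume x': "x' \<in> States M" "dist x' x0 < d"
    have "\<bar>?g (x', a) - ?g (x0, a)\<bar> \<le> e / 2" if "a \<in> Actions M" for a
      using d(2)[of "(x0, a)" "(x', a)"] x x' that by (simp add: dist_Pair_Pair dist_real_def)
    then have "\<bar>bellman w x' - bellman w x0\<bar> \<le> e / 2"
      unfolding bellman_def
      by (intro abs_INF_diff_le actions_nonempty bdd_below_backup w x x') auto
    then show "dist (bellman w x') (bellman w x0) < e" using e by (simp add: dist_real_def)
  qed (rule d(1))
qed

lemma bellman_contraction: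
  assumes "continuous_on (States M) w" "continuous_on (States M) v"
    and "\<And>x. x \<in> States M \<Longrightarrow> \<bar>w x - v x\<bar> \<le> K" and x: "x \<in> States M"
  shows "\<bar>bellman w x - bellman v x\<bar> \<le> disc M * K"
  unfolding bellman_def
proof (intro abs_INF_diff_le actions_nonempty bdd_below_backup assms(1,2) x)
  fix a assume a: "a \<in> Actions M"
  have "\<bar>c (x, a) + disc M * P_op M w (x, a) - (c (x, a) + disc M * P_op M v (x, a))\<bar>
      = disc M * \<bar>P_op M w (x, a) - P_op M v (x, a)\<bar>"
    using disc_bounds by (simp add: abs_mult flip: right_diff_distrib)
  also have "\<dots> \<le> disc M * K"
    using disc_bounds P_op_diff_bound[OF _ assms(1-3), of "(x, a)"] x a by (intro mult_left_mono) auto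
  finally show "\<bar>c (x, a) + disc M * P_op M w (x, a) - (c (x, a) + disc M * P_op M v (x, a))\<bar> \<le> disc M * K" .
qed

text \<open>Value iteration from \<open>0\<close> converges uniformly on the state space by the contraction property.\<close>
lemma bellman_fixed_point:
  obtains w where "continuous_on (States M) w" "\<And>x. x \<in> States M \<Longrightarrow> bellman w x = w x"
proof -
  define W where "W n = (bellman ^^ n) (\<lambda>_. 0)" for n
  have W0: "W 0 = (\<lambda>_. 0)" and WS: "W (Suc n) = bellman (W n)" for n by (auto simp: W_def)
  have cW: "continuous_on (States M) (W n)" for n
    by (induction n) (auto simp: W0 WS intro: continuous_bellman)
  obtain K where K: "\<And>x. x \<in> States M \<Longrightarrow> \<bar>W 1 x\<bar> \<le> K"
    using compact_continuous_bounded[OF compact_states cW[of 1]] by metis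
  have step: "\<bar>W (Suc n) x - W n x\<bar> \<le> disc M ^ n * K" if "x \<in> States M" for n x
    using that
  proof (induction n arbitrary: x)
    case 0
    then show ?case using K by (simp add: W0)
  next
    case (Suc n)
    then show ?case
      using bellman_contraction[OF cW[of "Suc n"] cW[of n], of "disc M ^ n * K" x]
      by (simp add: WS mult.assoc)
  qed
  have "summable (\<lambda>n. disc M ^ n * K)"
    using disc_bounds by (intro summable_mult2 summable_geometric) auto
  from Weierstrass_m_test[of "States M" "\<lambda>n x. W (Suc n) x - W n x", OF _ this]
  have "uniform_limit (States M) (\<lambda>n x. \<Sum>i<n. W (Suc i) x - W i x) (\<lambda>x. \<Sum>i. W (Suc i) x - W i x) sequentially"
    using step by simp
  moreover have "(\<Sum>i<n. W (Suc i) x - W i x) = W n x" for n x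
    using sum_lessThan_telescope[of "\<lambda>i. W i x" n] by (simp add: W0)
  ultimately obtain w where lim: "uniform_limit (States M) W w sequentially" by simp
  have cw: "continuous_on (States M) w"
    by (rule uniform_limit_theorem[OF _ lim]) (auto simp: cW)
  have "bellman w x = w x" if x: "x \<in> States M" for x
  proof -
    have "\<bar>bellman w x - w x\<bar> \<le> 0 + e" if e: "0 < e" for e
    proof -
      have "\<forall>\<^sub>F n in sequentially. \<forall>x\<in>States M. dist (W n x) (w x) < e / 2"
        using uniform_limitD[OF lim, of "e / 2"] e by simp
      then obtain n where n: "\<And>m x. n \<le> m \<Longrightarrow> x \<in> States M \<Longrightarrow> \<bar>W m x - w x\<bar> < e / 2"
        by (auto simp: eventually_sequentially dist_real_def)
      have "\<bar>bellman w x - bellman (W n) x\<bar> \<le> disc M * (e / 2)"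
        using n by (intro bellman_contraction cw cW x) (auto simp: abs_minus_commute less_imp_le)
      also have "\<dots> \<le> e / 2" using disc_bounds e by (simp add: mult_left_le_one_le)
      finally have "\<bar>bellman w x - bellman (W n) x\<bar> \<le> e / 2" .
      moreover have "\<bar>bellman (W n) x - w x\<bar> < e / 2" using n[of "Suc n" x] x by (simp add: WS)
      ultimately show ?thesis by linarith
    qed
    then have "\<bar>bellman w x - w x\<bar> \<le> 0" by (rule field_le_epsilon)
    then show ?thesis by simp
  qed
  with cw that show ?thesis by blast
qed

lemma bellman_gap_nonneg:
  assumes w: "continuous_on (States M) w" and fp: "\<And>x. x \<in> States M \<Longrightarrow> bellman w x = w x"
    and p: "p \<in> States M \<times> Actions M"
  shows "T_adj M w p \<le> c p"
proof -
  obtain x a where xa: "p = (x, a)" "x \<in> States M" "a \<in> Actions M" using p by auto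
  have "w x \<le> c (x, a) + disc M * P_op M w (x, a)"
    using cINF_lower[OF bdd_below_backup[OF w xa(2)] xa(3)] fp[OF xa(2)] by (simp add: bellman_def)
  then show ?thesis by (simp add: T_adj_def xa(1))
qed

text \<open>
  By uniform continuity an action that is near-greedy at \<open>y\<close> is near-greedy on a ball around \<open>y\<close> of a
  radius that does not depend on \<open>y\<close>. A state is sent to the action of the first centre, in an
  enumeration of a finite net, whose ball contains it; this rule is measurable.
\<close>
lemma near_greedy_selector:
  assumes w: "continuous_on (States M) w" and fp: "\<And>x. x \<in> States M \<Longrightarrow> bellman w x = w x"
    and e: "0 < e"
  obtains \<phi> where "\<phi> \<in> S \<rightarrow>\<^sub>M A" "\<And>x. x \<in> States M \<Longrightarrow> c (x, \<phi> x) - T_adj M w (x, \<phi> x) \<le> e"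
proof (cases "States M = {}")
  case True
  then have "(\<lambda>_. undefined) \<in> S \<rightarrow>\<^sub>M A"
    by (auto simp: space_restrict_space measurable_def)
  then show ?thesis using that True by blast
next
  case False
  let ?f = "\<lambda>p. c p - T_adj M w p"
  have "uniformly_continuous_on (States M \<times> Actions M) ?f"
    by (intro compact_uniformly_continuous compact_SA continuous_intros cost_continuous continuous_T_adj w)
  then obtain d where d: "d > 0" "\<And>p q. p \<in> States M \<times> Actions M \<Longrightarrow> q \<in> States M \<times> Actions M \<Longrightarrow>
      dist q p < d \<Longrightarrow> dist (?f q) (?f p) < e / 2"
    unfolding uniformly_continuous_on_def using e half_gt_zero by metis
  have "\<exists>a\<in>Actions M. ?f (x, a) < e / 2" if x: "x \<in> States M" for x
  proof -
    have "bellman w x < w x + e / 2" using fp[OF x] e by simp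
    then obtain a where "a \<in> Actions M" "c (x, a) + disc M * P_op M w (x, a) < w x + e / 2"
      unfolding bellman_def using cINF_less_iff[OF actions_nonempty bdd_below_backup[OF w x]] by auto
    then show ?thesis by (auto simp: T_adj_def intro!: bexI[of _ a])
  qed
  then obtain \<alpha> where \<alpha>: "\<And>x. x \<in> States M \<Longrightarrow> \<alpha> x \<in> Actions M" "\<And>x. x \<in> States M \<Longrightarrow> ?f (x, \<alpha> x) < e / 2"
    by metis
  obtain k where k: "k \<subseteq> States M" "finite k" "States M \<subseteq> (\<Union>x\<in>k. ball x d)"
  proof (rule compactE_image[OF compact_states, of "States M" "\<lambda>x. ball x d"])
    show "States M \<subseteq> (\<Union>x\<in>States M. ball x d)" using d(1) by force
  qed auto
  then have "k \<noteq> {}" using False by auto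
  from range_from_nat_into[OF this countable_finite[OF k(2)]]
  have rk: "range (from_nat_into k) = k" .
  define \<iota> where "\<iota> x = (LEAST i. dist (from_nat_into k i) x < d)" for x
  have \<iota>: "dist (from_nat_into k (\<iota> x)) x < d" if x: "x \<in> States M" for x
  proof -
    obtain y where "y \<in> k" "dist y x < d" using subsetD[OF k(3) x] by auto
    then have "y \<in> range (from_nat_into k)" by (simp only: rk)
    then obtain i where "y = from_nat_into k i" by blast
    with \<open>dist y x < d\<close> have "dist (from_nat_into k i) x < d" by simp
    then show ?thesis unfolding \<iota>_def by (rule LeastI)
  qed
  have in_k: "from_nat_into k i \<in> States M" for i using rk k(1) by auto
  define \<phi> where "\<phi> x = \<alpha> (from_nat_into k (\<iota> x))" for x
  have "(\<lambda>x. x) \<in> S \<rightarrow>\<^sub>M borel" by (rule measurable_restrict_space1) simp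
  then have [measurable]: "Measurable.pred S (\<lambda>x. dist (from_nat_into k i) x < d)" for i
    by measurable
  have "\<iota> \<in> S \<rightarrow>\<^sub>M count_space UNIV"
    unfolding \<iota>_def[abs_def] by measurable
  moreover have "(\<lambda>i. \<alpha> (from_nat_into k i)) \<in> count_space UNIV \<rightarrow>\<^sub>M A"
    using \<alpha>(1) in_k by (auto simp: space_restrict_space)
  ultimately have "\<phi> \<in> S \<rightarrow>\<^sub>M A"
    unfolding \<phi>_def[abs_def] by (rule measurable_compose)
  moreover have "?f (x, \<phi> x) \<le> e" if x: "x \<in> States M" for x
  proof -
    let ?y = "from_nat_into k (\<iota> x)"
    have "\<phi> x \<in> Actions M" "?f (?y, \<phi> x) < e / 2"
      using \<alpha>[OF in_k] by (simp_all add: \<phi>_def)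
    moreover have "dist (x, \<phi> x) (?y, \<phi> x) < d"
      using \<iota>[OF x] by (simp add: dist_Pair_Pair dist_commute)
    ultimately have "dist (?f (x, \<phi> x)) (?f (?y, \<phi> x)) < e / 2"
      using x in_k by (intro d(2)) auto
    with \<open>?f (?y, \<phi> x) < e / 2\<close> show ?thesis
      unfolding dist_real_def by linarith
  qed
  ultimately show ?thesis using that by blast
qed

lemma stationary_subset_policies: "stationary_policies M \<subseteq> policies M"
proof
  fix \<pi> :: "('x, 'a) policy" assume "\<pi> \<in> stationary_policies M"
  then obtain \<phi> where \<phi>: "\<pi> = (\<lambda>t h x. \<phi> x)" "\<phi> \<in> S \<rightarrow>\<^sub>M prob_algebra A"
    unfolding stationary_policies_def by (rule imageE)
  have "(\<lambda>p. \<phi> (snd p)) \<in> Hist t \<Otimes>\<^sub>M S \<rightarrow>\<^sub>M prob_algebra A" for t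
    by (rule measurable_compose[OF measurable_snd \<phi>(2)])
  then show "\<pi> \<in> policies M" by (simp add: policies_def \<phi>(1) case_prod_beta')
qed

text \<open>
  The value of a policy exceeds \<open>\<langle>\<nu>, w\<rangle>\<close> by the discounted sum of the gap \<open>c - T* w\<close>, which is
  therefore the suboptimality of the policy when \<open>w\<close> solves the Bellman equation.
\<close>
lemma policy_value_gap:
  assumes w: "continuous_on (States M) w" and \<pi>: "\<pi> \<in> policies M" and \<nu>: "\<nu> \<in> space (prob_algebra S)"
  shows "policy_value M (\<lambda>p. c p - T_adj M w p) \<pi> \<nu> = policy_value M c \<pi> \<nu> - (LINT x|\<nu>. w x)"
proof -
  interpret mdp_run M \<pi> \<nu> by standard (use \<pi> \<nu> in auto)
  obtain B where B: "\<And>x. x \<in> States M \<Longrightarrow> \<bar>w x\<bar> \<le> B" using compact_continuous_bounded[OF compact_states w] by metis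
  note m = borel_measurable_continuous_on_restrict[OF w]
  show ?thesis
    using policy_value_diff[OF continuous_bounded_measurable[OF cost_continuous] T_adj_bounded_measurable[OF m B]]
      policy_value_T_adj[OF m B] by simp
qed

text \<open>
  The gap of the fixed point is nonnegative, which gives the lower bound, and near-greedy rules make
  the discounted sum of the gap arbitrarily small.
\<close>
lemma opt_value_fixed_point:
  assumes w: "continuous_on (States M) w" and fp: "\<And>x. x \<in> States M \<Longrightarrow> bellman w x = w x"
    and \<nu>: "\<nu> \<in> space (prob_algebra S)"
  shows "opt_value M c \<nu> = (LINT x|\<nu>. w x)"
proof -
  let ?f = "\<lambda>p. c p - T_adj M w p"
  have bm: "bounded_measurable M ?f"
    by (intro continuous_bounded_measurable continuous_intros cost_continuous continuous_T_adj w)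
  have lower: "(LINT x|\<nu>. w x) \<le> policy_value M c \<pi> \<nu>" if \<pi>: "\<pi> \<in> stationary_policies M" for \<pi>
  proof -
    have pol: "\<pi> \<in> policies M" using \<pi> stationary_subset_policies by blast
    interpret mdp_run M \<pi> \<nu> by standard (use pol \<nu> in auto)
    have "0 / (1 - disc M) \<le> policy_value M ?f \<pi> \<nu>"
      using bellman_gap_nonneg[OF w fp] by (intro policy_value_bounds(2)[OF bm]) auto
    then show ?thesis using policy_value_gap[OF w pol \<nu>] by simp
  qed
  have upper: "\<exists>\<pi>\<in>stationary_policies M. policy_value M c \<pi> \<nu> \<le> (LINT x|\<nu>. w x) + e" if e: "0 < e" for e
  proof -
    have e': "0 < e * (1 - disc M)" using e disc_bounds by simp
    obtain \<phi> where \<phi>: "\<phi> \<in> S \<rightarrow>\<^sub>M A" "\<And>x. x \<in> States M \<Longrightarrow> ?f (x, \<phi> x) \<le> e * (1 - disc M)"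
      using near_greedy_selector[OF w fp e'] by metis
    let ?\<pi> = "(\<lambda>t h x. return A (\<phi> x)) :: ('x, 'a) policy"
    have "(\<lambda>x. return A (\<phi> x)) \<in> S \<rightarrow>\<^sub>M prob_algebra A"
      by (rule measurable_compose[OF \<phi>(1) measurable_return_prob_space])
    then have st: "?\<pi> \<in> stationary_policies M" by (auto simp: stationary_policies_def)
    then have pol: "?\<pi> \<in> policies M" using stationary_subset_policies by blast
    interpret mdp_run M ?\<pi> \<nu> by standard (use pol \<nu> in auto)
    note det = policy_value_deterministic[OF \<phi>(1) refl bm]
    have "policy_value M ?f ?\<pi> \<nu> \<le> e * (1 - disc M) / (1 - disc M)"
      unfolding det(1) using \<phi>(2) by (intro policy_value_bounds(1)[OF det(2)]) auto
    then have "policy_value M c ?\<pi> \<nu> \<le> (LINT x|\<nu>. w x) + e"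
      using policy_value_gap[OF w pol \<nu>] disc_bounds by simp
    with st show ?thesis by blast
  qed
  then have ne: "stationary_policies M \<noteq> {}" using zero_less_one by blast
  show ?thesis
  proof (rule antisym)
    have bdd: "bdd_below ((\<lambda>\<pi>. policy_value M c \<pi> \<nu>) ` stationary_policies M)"
      using lower by (rule bdd_belowI2)
    show "opt_value M c \<nu> \<le> (LINT x|\<nu>. w x)"
    proof (rule field_le_epsilon)
      fix e :: real assume "0 < e"
      from upper[OF this] show "opt_value M c \<nu> \<le> (LINT x|\<nu>. w x) + e"
        unfolding opt_value_def by (auto intro: cINF_lower2[OF bdd])
    qed
    show "(LINT x|\<nu>. w x) \<le> opt_value M c \<nu>"
      unfolding opt_value_def using lower by (intro cINF_greatest[OF ne])
  qed
qed

theorem optimal_value_function: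
  shows "continuous_on (States M) (opt_value_fun M c)"
    and "p \<in> States M \<times> Actions M \<Longrightarrow> T_adj M (opt_value_fun M c) p \<le> c p"
    and "optimal_policy M c \<pi> \<Longrightarrow>
      policy_value M (\<lambda>p. c p - T_adj M (opt_value_fun M c) p) \<pi> (init M) = 0"
proof -
  obtain w where w: "continuous_on (States M) w" and fp: "\<And>x. x \<in> States M \<Longrightarrow> bellman w x = w x"
    using bellman_fixed_point by metis
  have eq: "opt_value_fun M c x = w x" if x: "x \<in> States M" for x
  proof -
    have x': "x \<in> space S" using x by (simp add: space_restrict_space)
    then have "return S x \<in> space (prob_algebra S)"
      by (rule measurable_space[OF measurable_return_prob_space])
    then have "opt_value_fun M c x = (LINT y|return S x. w y)"
      unfolding opt_value_fun_def by (intro opt_value_fixed_point w fp)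
    also have "\<dots> = w x"
      by (rule integral_return[OF x' borel_measurable_continuous_on_restrict[OF w]])
    finally show ?thesis .
  qed
  show cu: "continuous_on (States M) (opt_value_fun M c)"
    using w eq by (simp cong: continuous_on_cong)
  have "bellman (opt_value_fun M c) x = bellman w x" if "x \<in> States M" for x
    unfolding bellman_def using that eq
    by (intro INF_cong refl arg_cong2[where f = "(+)"] arg_cong2[where f = "(*)"] P_op_cong) auto
  then have fpu: "bellman (opt_value_fun M c) x = opt_value_fun M c x" if "x \<in> States M" for x
    using that fp eq by simp
  show "p \<in> States M \<times> Actions M \<Longrightarrow> T_adj M (opt_value_fun M c) p \<le> c p"
    by (rule bellman_gap_nonneg[OF cu fpu])
  have init: "init M \<in> space (prob_algebra S)" using mdp by (simp add: is_mdp_def)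
  have opt: "opt_value M c (init M) = (LINT x|init M. opt_value_fun M c x)"
    by (intro opt_value_fixed_point cu fpu init)
  assume "optimal_policy M c \<pi>"
  then have "\<pi> \<in> policies M" "policy_value M c \<pi> (init M) = opt_value M c (init M)"
    by (simp_all add: optimal_policy_def)
  then show "policy_value M (\<lambda>p. c p - T_adj M (opt_value_fun M c) p) \<pi> (init M) = 0"
    by (simp only: policy_value_gap[OF cu _ init] opt diff_self)
qed

end

section \<open>Feasible points of the inverse program\<close>

text \<open>
  In the application \<open>I\<close> is the integral of the approximate gap, \<open>\<delta>\<close> bounds its deficit, \<open>r\<close> is the
  scaling factor of the gap and \<open>s\<close> the shift of the coefficient of the constant function.
\<close>
lemma mixing_weights:
  fixes \<gamma> d \<theta> I \<delta> :: real
  assumes \<gamma>: "0 < \<gamma>" "\<gamma> < 1" and d: "0 < d" and \<theta>: "1 / ((1 - \<gamma>) * min 1 d) < \<theta>"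
    and \<delta>: "1 - I \<le> \<delta>" "0 \<le> \<delta>"
  obtains r s where "0 \<le> r" "r \<le> 1" "0 \<le> s" "r * \<theta> + s \<le> \<theta>" "r * I + s * ((1 - \<gamma>) * d) = 1"
    "s \<le> \<theta> * \<delta> / ((1 - \<gamma>) * min 1 d * \<theta> - 1)"
proof -
  define G where "G = (1 - \<gamma>) * d * \<theta> - 1"
  define Gm where "Gm = (1 - \<gamma>) * min 1 d * \<theta> - 1"
  have pos: "0 < (1 - \<gamma>) * min 1 d" using \<gamma> d by simp
  then have "0 < 1 / ((1 - \<gamma>) * min 1 d)" by (rule divide_pos_pos[OF zero_less_one])
  then have \<theta>0: "0 < \<theta>" using \<theta> by linarith
  have Gm: "0 < Gm" using \<theta> pos by (simp add: Gm_def pos_divide_less_eq mult.commute)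
  have "(1 - \<gamma>) * min 1 d * \<theta> \<le> (1 - \<gamma>) * d * \<theta>"
    using \<gamma> \<theta>0 by (intro mult_right_mono mult_left_mono) auto
  then have GGm: "Gm \<le> G" by (simp add: G_def Gm_def)
  have bound: "0 \<le> \<theta> * \<delta> / Gm" using \<theta>0 \<delta> Gm by simp
  show ?thesis
  proof (cases "1 \<le> I")
    case True
    then show ?thesis
      using that[of "1 / I" 0] \<theta>0 bound by (auto simp: Gm_def field_simps)
  next
    case False
    define \<eta> where "\<eta> = 1 - I"
    have \<eta>: "0 < \<eta>" "\<eta> \<le> \<delta>" using False \<delta> by (auto simp: \<eta>_def)
    have Gp: "0 < G + \<eta>" using Gm GGm \<eta> by linarith
    \<comment> \<open>The weight \<open>l\<close> solves \<open>(1 - l) (1 - \<eta>) + l (1 + G) = 1\<close>, where \<open>1 + G\<close> is the integral of the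
      constant gap \<open>\<theta> (1 - \<gamma>)\<close>.\<close>
    define l where "l = \<eta> / (G + \<eta>)"
    have l: "0 \<le> l" "l \<le> 1" "l * (G + \<eta>) = \<eta>"
      using Gm GGm \<eta> Gp by (auto simp: l_def)
    have "(1 - l) * I + l * \<theta> * ((1 - \<gamma>) * d) = 1 - \<eta> + l * (G + \<eta>)"
      by (simp add: G_def \<eta>_def algebra_simps)
    then have one: "(1 - l) * I + l * \<theta> * ((1 - \<gamma>) * d) = 1" using l by simp
    have "l \<le> \<delta> / Gm"
      unfolding l_def using Gm GGm \<eta> by (intro frac_le) auto
    then have "l * \<theta> \<le> \<theta> * \<delta> / Gm"
      using mult_right_mono[of l "\<delta> / Gm" \<theta>] \<theta>0 by (simp add: mult.commute)
    with one l \<theta>0 show ?thesis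
      using that[of "1 - l" "l * \<theta>"] by (auto simp: Gm_def algebra_simps)
  qed
qed

context control_model
begin

lemma set_integrable_SA:
  fixes f :: "_ \<Rightarrow> real"
  assumes "continuous_on (States M \<times> Actions M) f"
  shows "set_integrable lborel (States M \<times> Actions M) f"
  unfolding set_integrable_def by (rule borel_integrable_compact[OF compact_SA assms])

lemma leb_integral_SA_const: "leb_integral_SA M (\<lambda>_. r) = r * leb_SA M"
proof -
  have "States M \<times> Actions M \<in> sets borel" using compact_SA by (rule borel_compact)
  moreover have "emeasure lborel (States M \<times> Actions M) < \<infinity>"
    using compact_SA by (rule emeasure_compact_finite)
  ultimately show ?thesis
    by (simp add: leb_integral_SA_def leb_SA_def set_lebesgue_integral_def mult.commute)
qed

lemma leb_integral_SA_affine: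
  assumes "continuous_on (States M \<times> Actions M) f"
    and "\<And>p. p \<in> States M \<times> Actions M \<Longrightarrow> g p = r * f p + s"
  shows "leb_integral_SA M g = r * leb_integral_SA M f + s * leb_SA M"
proof -
  have "leb_integral_SA M g = leb_integral_SA M (\<lambda>p. r * f p + s)"
    unfolding leb_integral_SA_def set_lebesgue_integral_def
    by (rule Bochner_Integration.integral_cong[OF refl]) (auto simp: assms(2) indicator_def)
  also have "\<dots> = leb_integral_SA M (\<lambda>p. r * f p) + leb_integral_SA M (\<lambda>_. s)"
    unfolding leb_integral_SA_def
    by (intro set_integral_add set_integrable_SA continuous_intros assms(1))
  finally show ?thesis
    unfolding leb_integral_SA_const by (simp add: leb_integral_SA_def)
qed

lemma leb_integral_SA_diff_le:
  assumes f: "continuous_on (States M \<times> Actions M) f" and g: "continuous_on (States M \<times> Actions M) g"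
    and le: "\<And>p. p \<in> States M \<times> Actions M \<Longrightarrow> f p \<le> g p + b"
  shows "leb_integral_SA M f \<le> leb_integral_SA M g + b * leb_SA M"
proof -
  have "leb_integral_SA M f \<le> leb_integral_SA M (\<lambda>p. g p + b)"
    unfolding leb_integral_SA_def
    by (intro set_integral_mono set_integrable_SA continuous_intros f g le)
  also have "\<dots> = leb_integral_SA M g + b * leb_SA M"
    using leb_integral_SA_affine[OF g, of "\<lambda>p. g p + b" 1 b] by simp
  finally show ?thesis .
qed

text \<open>
  Scaling both coefficient vectors by \<open>r\<close> and then lowering the coefficient of \<open>u\<^sub>1 = 1\<close> by \<open>s\<close> turns
  \<open>f = c - T* u\<close> into \<open>r f + s (1 - \<gamma>)\<close>, because \<open>T* 1 = 1 - \<gamma>\<close>.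
\<close>
lemma scaled_shifted_feasible:
  assumes cc: "\<And>i. i \<in> {1..nc} \<Longrightarrow> continuous_on (States M \<times> Actions M) (cs i)"
    and cu: "\<And>j. j \<in> {1..nu} \<Longrightarrow> continuous_on (States M) (us j)"
    and nu: "1 \<le> nu" and one: "\<And>x. x \<in> States M \<Longrightarrow> us 1 x = 1"
    and \<pi>: "\<pi> \<in> policies M"
    and \<alpha>: "\<alpha> \<in> l1_ball nc \<theta>" and \<beta>: "\<beta> \<in> l1_ball nu \<theta>"
    and f: "f = (\<lambda>p. lin_comb nc \<alpha> cs p - T_adj M (lin_comb nu \<beta> us) p)"
    and occ: "policy_value M f \<pi> (init M) \<le> \<epsilon>"
    and low: "\<And>p. p \<in> States M \<times> Actions M \<Longrightarrow> - \<epsilon> \<le> f p" and \<epsilon>: "0 \<le> \<epsilon>"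
    and r: "0 \<le> r" and s: "0 \<le> s" and rs: "r * \<theta> + s \<le> \<theta>"
    and int: "r * leb_integral_SA M f + s * ((1 - disc M) * leb_SA M) = 1"
  shows "((\<lambda>i. r * \<alpha> i), (\<lambda>j. r * \<beta> j - (if j = 1 then s else 0)), r * \<epsilon> + s)
    \<in> IP_feasible M \<pi> \<theta> nc cs nu us"
proof -
  let ?\<alpha> = "\<lambda>i. r * \<alpha> i" and ?\<beta> = "\<lambda>j. r * \<beta> j - (if j = 1 then s else 0)"
  let ?v = "lin_comb nu \<beta> us" and ?v' = "lin_comb nu ?\<beta> us"
  let ?f' = "\<lambda>p. lin_comb nc ?\<alpha> cs p - T_adj M ?v' p"
  have init: "init M \<in> space (prob_algebra S)" using mdp by (simp add: is_mdp_def)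
  interpret mdp_run M \<pi> "init M" by standard (use \<pi> init in auto)
  have cv: "continuous_on (States M) ?v" by (rule continuous_lin_comb[OF cu])
  have cv': "continuous_on (States M) ?v'" by (rule continuous_lin_comb[OF cu])
  have cf: "continuous_on (States M \<times> Actions M) f"
    unfolding f by (intro continuous_intros continuous_lin_comb cc continuous_T_adj cv)
  have cf': "continuous_on (States M \<times> Actions M) ?f'"
    by (intro continuous_intros continuous_lin_comb cc continuous_T_adj cv')
  have v': "?v' x = r * ?v x + (- s) * 1" if "x \<in> States M" for x
  proof -
    have "?v' x = (\<Sum>j=1..nu. r * (\<beta> j * us j x) - (if j = 1 then s * us j x else 0))"
      unfolding lin_comb_def by (intro sum.cong) (auto simp: algebra_simps)
    also have "\<dots> = r * ?v x - s * us 1 x"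
      using nu by (simp add: lin_comb_def sum_subtractf sum_distrib_left)
    finally show ?thesis using one[OF that] by simp
  qed
  obtain B where B: "\<And>x. x \<in> States M \<Longrightarrow> \<bar>?v x\<bar> \<le> B"
    using compact_continuous_bounded[OF compact_states cv] by metis
  have f': "?f' p = r * f p + s * (1 - disc M)" if p: "p \<in> States M \<times> Actions M" for p
  proof -
    have "P_op M ?v' p = P_op M (\<lambda>x. r * ?v x + (- s) * 1) p"
      by (rule P_op_cong[OF p v'])
    also have "\<dots> = r * P_op M ?v p + (- s) * P_op M (\<lambda>_. 1) p"
      by (rule P_op_linear[OF p borel_measurable_continuous_on_restrict[OF cv] B, where C = 1]) auto
    finally have P: "P_op M ?v' p = r * P_op M ?v p - s" by (simp add: P_op_const[OF p])
    have v: "?v' (fst p) = r * ?v (fst p) - s" using p v'[of "fst p"] by auto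
    have g: "lin_comb nc ?\<alpha> cs p = r * lin_comb nc \<alpha> cs p"
      by (simp add: lin_comb_def sum_distrib_left mult.assoc)
    show ?thesis unfolding f T_adj_def P v g by (simp add: algebra_simps)
  qed
  have "?\<alpha> \<in> l1_ball nc \<theta>"
  proof -
    have "(\<Sum>i=1..nc. \<bar>r * \<alpha> i\<bar>) = r * (\<Sum>i=1..nc. \<bar>\<alpha> i\<bar>)"
      using r by (simp add: abs_mult sum_distrib_left)
    also have "\<dots> \<le> r * \<theta>" using \<alpha> r by (intro mult_left_mono) (auto simp: l1_ball_def)
    finally show ?thesis using rs s by (simp add: l1_ball_def)
  qed
  moreover have "?\<beta> \<in> l1_ball nu \<theta>"
  proof -
    have "(\<Sum>j=1..nu. \<bar>?\<beta> j\<bar>) \<le> (\<Sum>j=1..nu. r * \<bar>\<beta> j\<bar> + (if j = 1 then s else 0))"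
      using r s by (intro sum_mono) (auto simp: abs_mult intro!: order.trans[OF abs_triangle_ineq4])
    also have "\<dots> = r * (\<Sum>j=1..nu. \<bar>\<beta> j\<bar>) + s"
      using nu by (simp add: sum.distrib sum_distrib_left)
    also have "\<dots> \<le> r * \<theta> + s"
      using \<beta> r by (intro add_right_mono mult_left_mono) (auto simp: l1_ball_def)
    finally show ?thesis using rs by (simp add: l1_ball_def)
  qed
  moreover have "0 \<le> r * \<epsilon> + s" using r s \<epsilon> by simp
  moreover have "(LINT p|occupancy M \<pi>. ?f' p) \<le> r * \<epsilon> + s"
  proof -
    note bm = continuous_bounded_measurable[OF cf]
    have bc: "bounded_measurable M (\<lambda>_. - (s * (1 - disc M)))"
      by (intro continuous_bounded_measurable continuous_intros)
    have "(LINT p|occupancy M \<pi>. ?f' p) = policy_value M ?f' \<pi> (init M)"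
      by (rule integral_occupancy[OF refl continuous_bounded_measurable[OF cf']])
    also have "\<dots> = policy_value M (\<lambda>p. r * f p - - (s * (1 - disc M))) \<pi> (init M)"
      using f' by (intro policy_value_cong) simp
    also have "\<dots> = r * policy_value M f \<pi> (init M) + s"
      using disc_bounds
      by (simp only: policy_value_diff[OF bounded_measurable_mult[OF bm] bc] policy_value_mult[OF bm] policy_value_const)
        simp
    also have "\<dots> \<le> r * \<epsilon> + s" using occ r by (intro add_right_mono mult_left_mono)
    finally show ?thesis .
  qed
  moreover have "- (r * \<epsilon> + s) \<le> ?f' p" if p: "p \<in> States M \<times> Actions M" for p
  proof -
    have "r * - \<epsilon> \<le> r * f p" using low[OF p] r by (rule mult_left_mono)
    moreover have "0 \<le> s * (1 - disc M)" using s disc_bounds by simp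
    ultimately show ?thesis unfolding f'[OF p] using s by linarith
  qed
  moreover have "leb_integral_SA M ?f' = 1"
    using leb_integral_SA_affine[OF cf f'] int by (simp add: mult.assoc)
  ultimately show ?thesis unfolding IP_feasible_def Let_def by blast
qed

text \<open>
  The occupancy bound uses the adjoint relation for \<open>u* - v\<close>; integrating the pointwise bound instead
  would give the larger constant \<open>(e1 + (1 + \<gamma>) e2) / (1 - \<gamma>)\<close>.
\<close>
lemma approximate_gap:
  assumes g: "continuous_on (States M \<times> Actions M) g" and v: "continuous_on (States M) v"
    and e1: "\<And>p. p \<in> States M \<times> Actions M \<Longrightarrow> \<bar>c p - g p\<bar> \<le> e1"
    and e2: "\<And>x. x \<in> States M \<Longrightarrow> \<bar>opt_value_fun M c x - v x\<bar> \<le> e2"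
  shows "p \<in> States M \<times> Actions M \<Longrightarrow>
      \<bar>c p - T_adj M (opt_value_fun M c) p - (g p - T_adj M v p)\<bar> \<le> e1 + (1 + disc M) * e2"
    and "optimal_policy M c \<pi> \<Longrightarrow>
      policy_value M (\<lambda>p. g p - T_adj M v p) \<pi> (init M) \<le> e1 / (1 - disc M) + e2"
proof -
  let ?u = "opt_value_fun M c"
  note u = optimal_value_function(1)
  note um = borel_measurable_continuous_on_restrict[OF u] and vm = borel_measurable_continuous_on_restrict[OF v]
  {
    assume p: "p \<in> States M \<times> Actions M"
    have "\<bar>disc M * (P_op M ?u p - P_op M v p)\<bar> \<le> disc M * e2"
      using P_op_diff_bound[OF p u v e2] disc_bounds by (simp add: abs_mult)
    moreover have "\<bar>?u (fst p) - v (fst p)\<bar> \<le> e2" "\<bar>c p - g p\<bar> \<le> e1" using p e1 e2 by auto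
    ultimately show "\<bar>c p - T_adj M ?u p - (g p - T_adj M v p)\<bar> \<le> e1 + (1 + disc M) * e2"
      by (simp add: T_adj_def algebra_simps abs_le_iff)
  }
  assume opt: "optimal_policy M c \<pi>"
  then have pol: "\<pi> \<in> policies M" by (simp add: optimal_policy_def)
  have init: "init M \<in> space (prob_algebra S)" using mdp by (simp add: is_mdp_def)
  interpret mdp_run M \<pi> "init M" by standard (use pol init in auto)
  obtain B where B: "\<And>x. x \<in> States M \<Longrightarrow> \<bar>?u x\<bar> \<le> B"
    using compact_continuous_bounded[OF compact_states u] by metis
  obtain C where C: "\<And>x. x \<in> States M \<Longrightarrow> \<bar>v x\<bar> \<le> C"
    using compact_continuous_bounded[OF compact_states v] by metis
  note bg = continuous_bounded_measurable[OF g]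
  note bc = continuous_bounded_measurable[OF cost_continuous]
  interpret i: prob_space "init M" using init by (simp add: space_prob_algebra)
  have si: "sets (init M) = sets S" using init by (simp add: space_prob_algebra)
  have sp: "space (init M) = States M"
    using sets_eq_imp_space_eq[OF si] by (simp add: space_restrict_space)
  have "integrable (init M) ?u"
    by (rule i.integrable_const_bound[of _ B])
      (use um B in \<open>auto simp: sp measurable_cong_sets[OF si refl]\<close>)
  moreover have "integrable (init M) v"
    by (rule i.integrable_const_bound[of _ C])
      (use vm C in \<open>auto simp: sp measurable_cong_sets[OF si refl]\<close>)
  ultimately have "(LINT x|init M. ?u x) \<le> (LINT x|init M. v x + e2)"
      and "(LINT x|init M. v x + e2) = (LINT x|init M. v x) + e2"
    using e2 by (intro integral_mono, auto simp: sp abs_le_iff algebra_simps i.prob_space[unfolded sp])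
  then have iu: "(LINT x|init M. ?u x) - (LINT x|init M. v x) \<le> e2" by linarith
  have "policy_value M (\<lambda>p. g p - c p) \<pi> (init M) \<le> e1 / (1 - disc M)"
    using e1 by (intro policy_value_bounds(1) bounded_measurable_diff bg bc) (auto simp: abs_le_iff)
  then have gc: "policy_value M g \<pi> (init M) - policy_value M c \<pi> (init M) \<le> e1 / (1 - disc M)"
    by (simp only: policy_value_diff[OF bg bc])
  have "policy_value M c \<pi> (init M) - (LINT x|init M. ?u x) = 0"
    using optimal_value_function(3)[OF opt] policy_value_gap[OF u pol init] by simp
  moreover have "policy_value M (\<lambda>p. g p - T_adj M v p) \<pi> (init M) = policy_value M g \<pi> (init M) - (LINT x|init M. v x)"
    using policy_value_diff[OF bg T_adj_bounded_measurable[OF vm C]] policy_value_T_adj[OF vm C] by simp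
  ultimately show "policy_value M (\<lambda>p. g p - T_adj M v p) \<pi> (init M) \<le> e1 / (1 - disc M) + e2"
    using iu gc by linarith
qed

text \<open>
  The bound for one pair of approximants. The first summand covers the violation of the two
  inequality constraints, the second one the repair of the normalization constraint.
\<close>
lemma IP_value_le:
  assumes cc: "\<And>i. i \<in> {1..nc} \<Longrightarrow> continuous_on (States M \<times> Actions M) (cs i)"
    and cu: "\<And>j. j \<in> {1..nu} \<Longrightarrow> continuous_on (States M) (us j)"
    and nu: "1 \<le> nu" and one: "\<And>x. x \<in> States M \<Longrightarrow> us 1 x = 1"
    and opt: "optimal_policy M c \<pi>"
    and \<alpha>: "\<alpha> \<in> l1_ball nc \<theta>" and \<beta>: "\<beta> \<in> l1_ball nu \<theta>"
    and e1: "\<And>p. p \<in> States M \<times> Actions M \<Longrightarrow> \<bar>c p - lin_comb nc \<alpha> cs p\<bar> \<le> e1"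
    and e2: "\<And>x. x \<in> States M \<Longrightarrow> \<bar>opt_value_fun M c x - lin_comb nu \<beta> us x\<bar> \<le> e2"
    and nonneg: "0 \<le> e1" "0 \<le> e2"
    and leb: "0 < leb_SA M" and \<theta>: "1 / ((1 - disc M) * min 1 (leb_SA M)) < \<theta>"
    and norm: "1 \<le> leb_integral_SA M (\<lambda>p. c p - T_adj M (opt_value_fun M c) p)"
  shows "IP_value M \<pi> \<theta> nc cs nu us \<le> ennreal ((2 - disc M) / (1 - disc M) * (e1 + e2)
    + \<theta> * (leb_SA M * (e1 + (1 + disc M) * e2)) / ((1 - disc M) * min 1 (leb_SA M) * \<theta> - 1))"
proof -
  let ?g = "lin_comb nc \<alpha> cs" and ?v = "lin_comb nu \<beta> us"
  define f where "f = (\<lambda>p. ?g p - T_adj M ?v p)"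
  define \<epsilon> where "\<epsilon> = (2 - disc M) / (1 - disc M) * (e1 + e2)"
  note disc = disc_bounds
  have g: "continuous_on (States M \<times> Actions M) ?g" by (rule continuous_lin_comb[OF cc])
  have v: "continuous_on (States M) ?v" by (rule continuous_lin_comb[OF cu])
  have gap: "\<bar>c p - T_adj M (opt_value_fun M c) p - f p\<bar> \<le> e1 + (1 + disc M) * e2"
    if "p \<in> States M \<times> Actions M" for p
    using approximate_gap(1)[OF g v e1 e2 that] by (simp add: f_def)
  have cf: "continuous_on (States M \<times> Actions M) f"
    unfolding f_def by (intro continuous_intros g continuous_T_adj v)
  have cf': "continuous_on (States M \<times> Actions M) (\<lambda>p. c p - T_adj M (opt_value_fun M c) p)"
    by (intro continuous_intros cost_continuous continuous_T_adj optimal_value_function(1))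
  have split: "(2 - disc M) / (1 - disc M) = 1 + 1 / (1 - disc M)"
    using disc by (simp add: field_simps)
  have q: "1 \<le> 1 / (1 - disc M)" using disc by simp
  have "1 * e2 \<le> 1 / (1 - disc M) * e2" "1 * e1 \<le> 1 / (1 - disc M) * e1"
    by (rule mult_right_mono[OF q nonneg(2)], rule mult_right_mono[OF q nonneg(1)])
  then have "e1 / (1 - disc M) + e2 \<le> \<epsilon>"
    using nonneg by (simp add: \<epsilon>_def split distrib_left distrib_right)
  then have occ: "policy_value M f \<pi> (init M) \<le> \<epsilon>"
    using approximate_gap(2)[OF g v e1 e2 opt] by (simp add: f_def)
  have "disc M * e2 \<le> 1 * e2" using disc nonneg by (intro mult_right_mono) auto
  then have "e1 + (1 + disc M) * e2 \<le> \<epsilon>"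
    using \<open>1 * e2 \<le> 1 / (1 - disc M) * e2\<close> \<open>1 * e1 \<le> 1 / (1 - disc M) * e1\<close> nonneg
    by (simp add: \<epsilon>_def split distrib_left distrib_right)
  then have low: "- \<epsilon> \<le> f p" if p: "p \<in> States M \<times> Actions M" for p
    using gap[OF p] optimal_value_function(2)[OF p] by (simp add: abs_le_iff)
  have \<epsilon>0: "0 \<le> \<epsilon>" using nonneg disc by (simp add: \<epsilon>_def)
  have "leb_integral_SA M (\<lambda>p. c p - T_adj M (opt_value_fun M c) p)
      \<le> leb_integral_SA M f + (e1 + (1 + disc M) * e2) * leb_SA M"
  proof (rule leb_integral_SA_diff_le[OF cf' cf])
    fix p assume "p \<in> States M \<times> Actions M"
    from gap[OF this] show "c p - T_adj M (opt_value_fun M c) p \<le> f p + (e1 + (1 + disc M) * e2)"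
      by linarith
  qed
  then have "1 - leb_integral_SA M f \<le> leb_SA M * (e1 + (1 + disc M) * e2)"
    using norm by (simp add: mult.commute)
  moreover have "0 \<le> leb_SA M * (e1 + (1 + disc M) * e2)" using leb nonneg disc by simp
  ultimately obtain r s where r: "0 \<le> r" "r \<le> 1" and s: "0 \<le> s" and rs: "r * \<theta> + s \<le> \<theta>"
    and int: "r * leb_integral_SA M f + s * ((1 - disc M) * leb_SA M) = 1"
    and s_le: "s \<le> \<theta> * (leb_SA M * (e1 + (1 + disc M) * e2)) / ((1 - disc M) * min 1 (leb_SA M) * \<theta> - 1)"
    using mixing_weights[OF disc leb \<theta>] by metis
  have pol: "\<pi> \<in> policies M" using opt by (simp add: optimal_policy_def)
  have "IP_value M \<pi> \<theta> nc cs nu us \<le> ennreal (r * \<epsilon> + s)"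
    unfolding IP_value_def
    by (rule INF_lower2[OF scaled_shifted_feasible[OF cc cu nu one pol \<alpha> \<beta> f_def occ low \<epsilon>0 r(1) s rs int]]) auto
  also have "r * \<epsilon> + s \<le> \<epsilon> + \<theta> * (leb_SA M * (e1 + (1 + disc M) * e2)) / ((1 - disc M) * min 1 (leb_SA M) * \<theta> - 1)"
    using r \<epsilon>0 s_le by (intro add_mono) (auto intro: mult_left_le_one_le)
  finally show ?thesis by (simp add: \<epsilon>_def ennreal_leI)
qed

end

lemma K_inf_nonneg: "1 \<le> n \<Longrightarrow> 0 \<le> K_inf X n f"
  unfolding K_inf_def by (intro Max_ge_iff[THEN iffD2]) auto

lemma K_inf_ge:
  assumes "i \<in> {1..n}" "sup_norm X (f i) < \<infinity>" "x \<in> X"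
  shows "\<bar>f i x\<bar> \<le> K_inf X n f"
proof -
  have "\<bar>f i x\<bar> \<le> enn2real (sup_norm X (f i))" using assms(2,3) by (rule abs_le_sup_norm)
  also have "\<dots> \<le> K_inf X n f" unfolding K_inf_def using assms(1) by (intro Max_ge) auto
  finally show ?thesis .
qed

theorem proposition4p2:
  fixes M :: "('x::euclidean_space, 'a::euclidean_space) mdp"
    and c_star :: "'x \<times> 'a \<Rightarrow> real" and u_star :: "'x \<Rightarrow> real"
    and \<pi>\<^sub>E :: "('x, 'a) policy"
    and c :: "nat \<Rightarrow> 'x \<times> 'a \<Rightarrow> real" and u :: "nat \<Rightarrow> 'x \<Rightarrow> real"
    and nc nu :: nat and L\<^sub>P L\<^sub>c L\<^sub>u \<theta> :: real
  assumes "is_mdp M"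
    and "lipschitz_control_model M L\<^sub>P c_star"
    and "1 \<le> nc" and "1 \<le> nu"
    and "\<forall>i\<in>{1..nc}. c i \<in> Lip sum_dist (States M \<times> Actions M)"
    and "lin_indep_on (States M \<times> Actions M) nc c"
    and "0 < L\<^sub>c" and "\<forall>i\<in>{1..nc}. lip_seminorm sum_dist (States M \<times> Actions M) (c i) \<le> ennreal L\<^sub>c"
    and "\<forall>j\<in>{1..nu}. u j \<in> Lip dist (States M)"
    and "lin_indep_on (States M) nu u"
    and "0 < L\<^sub>u" and "\<forall>j\<in>{1..nu}. lip_seminorm dist (States M) (u j) \<le> ennreal L\<^sub>u"
    and "optimal_policy M c_star \<pi>\<^sub>E"
    and "u_star = opt_value_fun M c_star"
    and "\<forall>x\<in>States M. u 1 x = 1"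
    and "0 < leb_SA M"
    and "1 / ((1 - disc M) * min 1 (leb_SA M)) < \<theta>"
    \<comment> \<open>The bound fails if the true cost is not normalized, e.g. for \<open>c_star = 0\<close>, where
        \<open>eps_approx = 0\<close> although the program enforces a cost with integral 1.\<close>
    and "1 \<le> leb_integral_SA M (\<lambda>p. c_star p - T_adj M u_star p)"
  shows "IP_value M \<pi>\<^sub>E \<theta> nc c nu u \<le> eps_approx M L\<^sub>P \<theta> nc c nu u c_star u_star"
proof -
  let ?SA = "States M \<times> Actions M"
  have ne: "?SA \<noteq> {}" using assms(16) by (auto simp: leb_SA_def)
  have "c_star \<in> Lip sum_dist ?SA" using assms(2) by (simp add: lipschitz_control_model_def)
  then have "continuous_on ?SA c_star" by (rule Lip_sum_dist_continuous)
  then interpret control_model M c_star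
    using assms(1,2) ne by unfold_locales (auto simp: lipschitz_control_model_def)
  note disc = disc_bounds
  define d where "d = leb_SA M"
  define Gm where "Gm = (1 - disc M) * min 1 d * \<theta> - 1"
  define D where "D = D_const M \<theta> nc c nu u"
  define Lmax where "Lmax = Max {1, L\<^sub>P, d}"
  define K where "K = (2 - disc M) / (1 - disc M) + D * (2 + disc M) * Lmax"
  have d: "0 < d" using assms(16) by (simp add: d_def)
  have pos: "0 < (1 - disc M) * min 1 d" using disc d by simp
  have \<theta>: "1 / ((1 - disc M) * min 1 d) < \<theta>" using assms(17) by (simp add: d_def)
  moreover have "0 < 1 / ((1 - disc M) * min 1 d)" using pos by (rule divide_pos_pos[OF zero_less_one])
  ultimately have \<theta>0: "0 < \<theta>" by linarith
  have Gm: "0 < Gm" using \<theta> pos by (simp add: Gm_def pos_divide_less_eq mult.commute)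
  have "1 \<le> K_inf (States M) nu u"
  proof -
    obtain x where x: "x \<in> States M" using ne by auto
    have "u 1 \<in> Lip dist (States M)" using assms(4,9) by simp
    then have "lip_norm dist (States M) (u 1) < \<infinity>" by (simp add: Lip_def)
    then have "sup_norm (States M) (u 1) < \<infinity>" using sup_norm_le_lip_norm by (rule le_less_trans[rotated])
    then show ?thesis using K_inf_ge[of 1 nu "States M" u x] assms(4,15) x by simp
  qed
  moreover have "0 \<le> K_inf ?SA nc c" using assms(3) by (rule K_inf_nonneg)
  ultimately have Ks: "1 \<le> K_inf ?SA nc c + K_inf (States M) nu u" by linarith
  \<comment> \<open>The denominator of \<open>D\<close> is \<open>(1 - \<gamma>) Gm\<close>, and the two maxima in its numerator add up to at
    least 1.\<close>
  have D_ge: "\<theta> / Gm \<le> D"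
  proof -
    have "(1 - disc M)\<^sup>2 * min 1 d * \<theta> + disc M - 1 = (1 - disc M) * Gm"
      by (simp add: Gm_def power2_eq_square algebra_simps)
    then have D_eq: "D = 2 * \<theta> * (K_inf ?SA nc c + K_inf (States M) nu u) / ((1 - disc M) * Gm)"
      by (simp add: D_def D_const_def d_def)
    have "\<theta> * 1 \<le> 2 * \<theta> * (K_inf ?SA nc c + K_inf (States M) nu u)"
      using Ks \<theta>0 by (intro mult_mono) auto
    moreover have "(1 - disc M) * Gm \<le> Gm" using disc Gm by simp
    ultimately show ?thesis
      unfolding D_eq using disc Gm \<theta>0 by (intro frac_le) auto
  qed
  then have D0: "0 \<le> D" using \<theta>0 Gm by (meson divide_nonneg_pos less_imp_le order.trans)
  have Lmax: "1 \<le> Lmax" "d \<le> Lmax" by (auto simp: Lmax_def)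
  have K0: "0 < K"
    using disc D0 Lmax by (auto simp: K_def intro!: add_pos_nonneg mult_nonneg_nonneg)
  \<comment> \<open>If an approximation error is infinite, positivity of the prefactor makes the bound infinite.\<close>
  have pair: "IP_value M \<pi>\<^sub>E \<theta> nc c nu u \<le> ennreal K *
      (lip_norm sum_dist ?SA (\<lambda>p. c_star p - g p) + lip_norm dist (States M) (\<lambda>x. u_star x - v x))"
    if gv: "g \<in> fun_class nc \<theta> c" "v \<in> fun_class nu \<theta> u" for g v
  proof (cases "lip_norm sum_dist ?SA (\<lambda>p. c_star p - g p) < \<infinity> \<and> lip_norm dist (States M) (\<lambda>x. u_star x - v x) < \<infinity>")
    case False
    then have infinite: "lip_norm sum_dist ?SA (\<lambda>p. c_star p - g p) + lip_norm dist (States M) (\<lambda>x. u_star x - v x) = top"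
      by (auto simp: not_less top_unique)
    show ?thesis unfolding infinite using K0 by (simp add: ennreal_mult_top)
  next
    case True
    obtain \<alpha> \<beta> where \<alpha>: "\<alpha> \<in> l1_ball nc \<theta>" "g = lin_comb nc \<alpha> c"
      and \<beta>: "\<beta> \<in> l1_ball nu \<theta>" "v = lin_comb nu \<beta> u"
      using gv by (auto simp: fun_class_def)
    define e1 where "e1 = enn2real (lip_norm sum_dist ?SA (\<lambda>p. c_star p - g p))"
    define e2 where "e2 = enn2real (lip_norm dist (States M) (\<lambda>x. u_star x - v x))"
    have e: "0 \<le> e1" "0 \<le> e2" by (auto simp: e1_def e2_def)
    have b1: "\<bar>c_star p - lin_comb nc \<alpha> c p\<bar> \<le> e1" if "p \<in> ?SA" for p
      using abs_le_lip_norm[OF conjunct1[OF True] that] by (simp add: e1_def \<alpha>)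
    have b2: "\<bar>opt_value_fun M c_star x - lin_comb nu \<beta> u x\<bar> \<le> e2" if "x \<in> States M" for x
      using abs_le_lip_norm[OF conjunct2[OF True] that] by (simp add: e2_def \<beta> assms(14))
    have cc: "continuous_on ?SA (c i)" if "i \<in> {1..nc}" for i
      using assms(5) that by (intro Lip_sum_dist_continuous) auto
    have cu: "continuous_on (States M) (u j)" if "j \<in> {1..nu}" for j
      using assms(9) that by (intro Lip_dist_continuous) auto
    have one: "u 1 x = 1" if "x \<in> States M" for x using assms(15) that by blast
    have "IP_value M \<pi>\<^sub>E \<theta> nc c nu u \<le> ennreal ((2 - disc M) / (1 - disc M) * (e1 + e2)
        + \<theta> * (d * (e1 + (1 + disc M) * e2)) / Gm)"
      unfolding Gm_def d_def
      by (rule IP_value_le[OF cc cu assms(4) one assms(13) \<alpha>(1) \<beta>(1) b1 b2 e assms(16,17) assms(18)[unfolded assms(14)]])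
    also have "\<dots> \<le> ennreal (K * (e1 + e2))"
    proof (rule ennreal_leI)
      have "e1 + (1 + disc M) * e2 \<le> (2 + disc M) * (e1 + e2)"
        using e disc by (simp add: algebra_simps)
      then have "d * (e1 + (1 + disc M) * e2) \<le> Lmax * ((2 + disc M) * (e1 + e2))"
        using Lmax d e disc by (intro mult_mono) auto
      then have "\<theta> / Gm * (d * (e1 + (1 + disc M) * e2)) \<le> D * (Lmax * ((2 + disc M) * (e1 + e2)))"
        using d e disc by (intro mult_mono[OF D_ge _ D0]) auto
      moreover have regroup: "(a + D * b * l) * t = a * t + D * (l * (b * t))" for a b l t :: real
        by (simp add: algebra_simps)
      have "K * (e1 + e2) = (2 - disc M) / (1 - disc M) * (e1 + e2) + D * (Lmax * ((2 + disc M) * (e1 + e2)))"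
        unfolding K_def by (rule regroup)
      ultimately show "(2 - disc M) / (1 - disc M) * (e1 + e2) + \<theta> * (d * (e1 + (1 + disc M) * e2)) / Gm \<le> K * (e1 + e2)"
        by simp
    qed
    also have "\<dots> = ennreal K * (ennreal e1 + ennreal e2)"
      using K0 e by (simp add: ennreal_mult ennreal_plus)
    finally show ?thesis using True by (simp add: e1_def e2_def)
  qed
  have "IP_value M \<pi>\<^sub>E \<theta> nc c nu u \<le> ennreal K *
      ((INF g\<in>fun_class nc \<theta> c. lip_norm sum_dist ?SA (\<lambda>p. c_star p - g p)) +
       (INF v\<in>fun_class nu \<theta> u. lip_norm dist (States M) (\<lambda>x. u_star x - v x)))"
    by (rule le_mult_INF_add_INF[OF K0 pair])
  then show ?thesis by (simp add: eps_approx_def K_def D_def Lmax_def d_def)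
qed

end
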